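(* Let $\mathscr{A}$ be an alphabet with $|\mathscr{A}| \geq 2$ and let $k$ be a positive integer. Consider monoid presentations over $\mathscr{A}$ with exactly $k$ relations and sum relation length $n$ (respectively, maximum relation length $n$). As $n \to \infty$, the proportion of such presentations which present left cancellative monoids tends to $\left( \frac{|\mathscr{A}|-1}{|\mathscr{A}|} \right)^{k}$, the proportion which present right cancellative monoids tends to $\left( \frac{|\mathscr{A}|-1}{|\mathscr{A}|} \right)^{k}$, and the proportion which present cancellative monoids tends to $\left( \frac{|\mathscr{A}|-1}{|\mathscr{A}|} \right)^{2k}$.
   Context: A monoid presentation $\langle \mathscr{A} \mid \mathscr{R} \rangle$ consists of an alphabet $\mathscr{A}$ and a set $\mathscr{R} \subseteq \mathscr{A}^* \times \mathscr{A}^*$ of relations (pairs of words); it has $k$ relations if $|\mathscr{R}| = k$. The monoid presented is $\mathscr{A}^*$ modulo the smallest congruence containing $\mathscr{R}$. The sum relation length is the total length of all words forming sides of relations, and the maximum relation length is the length of the longest word forming a side of a relation (or $0$ if there are none). A monoid is left [right] cancellative if $xy = xz$ [$yx = zx$] implies $y = z$, and cancellative if it is both. *)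

theory Defs
  imports Complex_Main
begin

definition is_presentation :: "'a set \<Rightarrow> ('a list \<times> 'a list) set \<Rightarrow> bool" where
  "is_presentation A R \<longleftrightarrow> R \<subseteq> lists A \<times> lists A"

inductive pres_cong :: "'a set \<Rightarrow> ('a list \<times> 'a list) set \<Rightarrow> 'a list \<Rightarrow> 'a list \<Rightarrow> bool"
  for A :: "'a set" and R :: "('a list \<times> 'a list) set" where
  base: "(u, v) \<in> R \<Longrightarrow> pres_cong A R u v"
| refl: "u \<in> lists A \<Longrightarrow> pres_cong A R u u"
| sym: "pres_cong A R u v \<Longrightarrow> pres_cong A R v u"
| trans: "pres_cong A R u v \<Longrightarrow> pres_cong A R v w \<Longrightarrow> pres_cong A R u w"
| compat: "pres_cong A R u v \<Longrightarrow> x \<in> lists A \<Longrightarrow> y \<in> lists A \<Longrightarrow>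
            pres_cong A R (x @ u @ y) (x @ v @ y)"

definition left_cancellative_pres :: "'a set \<Rightarrow> ('a list \<times> 'a list) set \<Rightarrow> bool" where
  "left_cancellative_pres A R \<longleftrightarrow>
     (\<forall>x\<in>lists A. \<forall>y\<in>lists A. \<forall>z\<in>lists A.
        pres_cong A R (x @ y) (x @ z) \<longrightarrow> pres_cong A R y z)"

definition right_cancellative_pres :: "'a set \<Rightarrow> ('a list \<times> 'a list) set \<Rightarrow> bool" where
  "right_cancellative_pres A R \<longleftrightarrow>
     (\<forall>x\<in>lists A. \<forall>y\<in>lists A. \<forall>z\<in>lists A.
        pres_cong A R (y @ x) (z @ x) \<longrightarrow> pres_cong A R y z)"

definition cancellative_pres :: "'a set \<Rightarrow> ('a list \<times> 'a list) set \<Rightarrow> bool" where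
  "cancellative_pres A R \<longleftrightarrow> left_cancellative_pres A R \<and> right_cancellative_pres A R"

definition sum_rel_length :: "('a list \<times> 'a list) set \<Rightarrow> nat" where
  "sum_rel_length R = (\<Sum>(u, v)\<in>R. length u + length v)"

definition max_rel_length :: "('a list \<times> 'a list) set \<Rightarrow> nat" where
  "max_rel_length R = Max (insert 0 ((\<lambda>(u, v). max (length u) (length v)) ` R))"

definition pres_sum :: "'a set \<Rightarrow> nat \<Rightarrow> nat \<Rightarrow> ('a list \<times> 'a list) set set" where
  "pres_sum A k n = {R. is_presentation A R \<and> finite R \<and> card R = k \<and> sum_rel_length R = n}"

definition pres_max :: "'a set \<Rightarrow> nat \<Rightarrow> nat \<Rightarrow> ('a list \<times> 'a list) set set" where
  "pres_max A k n = {R. is_presentation A R \<and> finite R \<and> card R = k \<and> max_rel_length R = n}"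

definition proportion :: "('b set \<Rightarrow> bool) \<Rightarrow> 'b set set \<Rightarrow> real" where
  "proportion P S = real (card {R \<in> S. P R}) / real (card S)"

end

theory Submission
  imports Defs "HOL-Combinatorics.Multiset_Permutations" "HOL-Real_Asymp.Real_Asymp"
begin

text \<open>
  With probability tending to one, the relation words of a random presentation all have length more
  than \<open>3p\<close>, with \<open>p \<approx> \<surd>n\<close>, and no word of length \<open>p\<close> occurs at two different places among
  them. Such a presentation is left cancellative if and only if the two sides of every relation start
  with different letters. If they start with the same letter \<open>a\<close>, deleting \<open>a\<close> leaves two distinct
  words to which no relation applies. Conversely, in a chain of elementary rewritings starting from
  \<open>as\<close>, the first letter can only be changed by applying a relation \<open>(u, v)\<close> to a prefix; from then on
  the beginning of \<open>v\<close> is frozen, so the next change of the first letter undoes this step. The right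
  handed version follows by reversing all words. Finally, among relation words of fixed lengths at
  least \<open>2\<close>, the first letters differ for a fraction \<open>(|A| - 1) / |A|\<close> of the pairs, independently for
  each relation and independently of the last letters.
\<close>

section \<open>Cancellativity under small overlap\<close>

text \<open>The identity counts as a step, so \<open>rewrite R ^^ n\<close> describes chains of at
  most \<open>n\<close> replacements and a chain may be padded to any greater length. The number of
  steps is kept because the later inductions run on it.\<close>

definition rewrite :: "('a list \<times> 'a list) set \<Rightarrow> 'a list \<Rightarrow> 'a list \<Rightarrow> bool" where
  "rewrite R w w' \<longleftrightarrow>
     w = w' \<or> (\<exists>x u v y. (u, v) \<in> R \<union> R\<inverse> \<and> w = x @ u @ y \<and> w' = x @ v @ y)"

lemma rewrite_refl [simp]: "rewrite R w w"
  by (simp add: rewrite_def)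

lemma rewrite_sym: "rewrite R w w' \<Longrightarrow> rewrite R w' w"
  unfolding rewrite_def by blast

lemma rewrite_context:
  assumes "rewrite R w w'"
  shows "rewrite R (x @ w @ y) (x @ w' @ y)"
proof (cases "w = w'")
  case False
  with assms obtain x' u v y' where "(u, v) \<in> R \<union> R\<inverse>" "w = x' @ u @ y'" "w' = x' @ v @ y'"
    unfolding rewrite_def by blast
  then have "(u, v) \<in> R \<union> R\<inverse>" "x @ w @ y = (x @ x') @ u @ (y' @ y)"
      "x @ w' @ y = (x @ x') @ v @ (y' @ y)"
    by simp_all
  then show ?thesis
    unfolding rewrite_def by blast
qed simp

lemma rewrites_mono:
  assumes "(rewrite R ^^ n) w w'" "n \<le> m"
  shows "(rewrite R ^^ m) w w'"
proof -
  have "(rewrite R ^^ d) w' w'" for d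
    by (induction d) auto
  then have "(rewrite R ^^ (n + (m - n))) w w'"
    using assms(1) by (auto simp: relpowp_add)
  then show ?thesis
    using assms(2) by simp
qed

lemma rewrites_trans:
  assumes "(rewrite R ^^ n) u v" "(rewrite R ^^ m) v w"
  shows "(rewrite R ^^ (n + m)) u w"
  using assms by (auto simp: relpowp_add)

lemma rewrites_sym: "(rewrite R ^^ n) w w' \<Longrightarrow> (rewrite R ^^ n) w' w"
proof (induction n arbitrary: w')
  case (Suc n)
  then obtain v where "(rewrite R ^^ n) w v" "rewrite R v w'"
    by auto
  then show ?case
    using Suc.IH rewrite_sym by (blast intro: relpowp_Suc_I2)
qed simp

lemma rewrites_context:
  "(rewrite R ^^ n) w w' \<Longrightarrow> (rewrite R ^^ n) (x @ w @ y) (x @ w' @ y)"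
proof (induction n arbitrary: w')
  case (Suc n)
  then obtain v where "(rewrite R ^^ n) w v" "rewrite R v w'"
    by auto
  then show ?case
    using Suc.IH rewrite_context by (blast intro: relpowp_Suc_I)
qed simp

lemma pres_cong_imp_rewrites:
  "pres_cong A R u v \<Longrightarrow> \<exists>n. (rewrite R ^^ n) u v"
proof (induction rule: pres_cong.induct)
  case (base u v)
  then have "(u, v) \<in> R \<union> R\<inverse>" "u = [] @ u @ []" "v = [] @ v @ []"
    by simp_all
  then have "rewrite R u v"
    unfolding rewrite_def by blast
  then show ?case
    by (metis relpowp_1)
next
  case (refl u)
  then show ?case
    by (metis relpowp_0_I)
qed (blast intro: rewrites_sym rewrites_trans rewrites_context)+

lemma rewrite_imp_pres_cong:
  assumes "is_presentation A R" "rewrite R w w'" "w \<in> lists A"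
  shows "pres_cong A R w w'"
proof (cases "w = w'")
  case False
  with assms(2) obtain x u v y where *: "(u, v) \<in> R \<union> R\<inverse>" "w = x @ u @ y" "w' = x @ v @ y"
    unfolding rewrite_def by blast
  then have "pres_cong A R u v"
    by (auto intro: pres_cong.base pres_cong.sym)
  then show ?thesis
    using * assms(3) by (auto intro: pres_cong.compat)
qed (use assms in \<open>auto intro: pres_cong.refl\<close>)

lemma pres_cong_in_lists:
  assumes "pres_cong A R u v" "is_presentation A R"
  shows "u \<in> lists A \<and> v \<in> lists A"
  using assms by (induction rule: pres_cong.induct) (auto simp: is_presentation_def)

lemma rewrites_imp_pres_cong:
  assumes "is_presentation A R" "(rewrite R ^^ n) w w'" "w \<in> lists A"
  shows "pres_cong A R w w'"
  using assms(2)
proof (induction n arbitrary: w')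
  case 0
  then show ?case
    using assms(3) by (auto intro: pres_cong.refl)
next
  case (Suc n)
  then obtain v where "(rewrite R ^^ n) w v" "rewrite R v w'"
    by auto
  then show ?case
    using Suc.IH rewrite_imp_pres_cong[OF assms(1)] pres_cong_in_lists[OF _ assms(1)]
    by (blast intro: pres_cong.trans)
qed

section \<open>Chains when factors of length \<open>p\<close> are unique\<close>

locale small_overlap =
  fixes R :: "('a list \<times> 'a list) set" and p :: nat
  assumes irreflexive: "(u, u) \<notin> R"
    and matching: "single_valued (R \<union> R\<inverse>)"
    and long: "w \<in> Field R \<Longrightarrow> 3 * p < length w"
    and factor_unique: "\<lbrakk>u \<in> Field R; v \<in> Field R; u = x @ q @ y; v = x' @ q @ y'; length q = p\<rbrakk>
      \<Longrightarrow> u = v \<and> x = x'"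
begin

lemma in_Field: "(u, v) \<in> R \<union> R\<inverse> \<Longrightarrow> u \<in> Field R \<and> v \<in> Field R"
  by (auto simp: Field_def)

text \<open>The first \<open>p\<close> letters of \<open>r\<close> occur in \<open>r\<close> at
  position 0, so any occurrence of them inside \<open>u\<close> has to be that one. Only this prefix
  is asked for, because in a longer word \<open>r\<close> may run past the end of
  \<open>u\<close>.\<close>

lemma relation_word_not_proper_factor:
  assumes "u \<in> Field R" "r \<in> Field R" "u = x @ take p r @ y"
  shows "x = []"
proof -
  have "r = [] @ take p r @ drop p r" "length (take p r) = p"
    using long[OF assms(2)] by simp_all
  then show ?thesis
    using factor_unique[OF assms(1,2,3)] by blast
qed

text \<open>A relation word \<open>r\<close> that starts inside \<open>q\<^sub>0\<close> must extend over all of \<open>q\<^sub>1\<close>; the induction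
  hypothesis, applied to the remainder of \<open>r\<close> and the reversed chain, shows that \<open>q\<^sub>1\<close> is then a
  factor of \<open>r\<close>.\<close>

lemma proper_suffix_frozen:
  assumes "v \<in> Field R" "v = x @ q\<^sub>0 @ q\<^sub>1" "x \<noteq> []" "length q\<^sub>1 = p"
    and "(rewrite R ^^ n) (q\<^sub>0 @ q\<^sub>1 @ t) w"
  shows "\<exists>s. w = q\<^sub>0 @ s \<and> (rewrite R ^^ n) (q\<^sub>1 @ t) s"
  using assms
proof (induction n arbitrary: v x q\<^sub>0 q\<^sub>1 t w)
  case 0
  then show ?case
    by auto
next
  case (Suc n)
  from Suc.prems(5) obtain y where y: "(rewrite R ^^ n) (q\<^sub>0 @ q\<^sub>1 @ t) y" "rewrite R y w"
    by auto
  then obtain s where s: "y = q\<^sub>0 @ s" "(rewrite R ^^ n) (q\<^sub>1 @ t) s"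
    using Suc.IH Suc.prems by blast
  have tail: ?case if "w = q\<^sub>0 @ s'" "rewrite R s s'" for s'
    using that s by (blast intro: relpowp_Suc_I)
  show ?case
  proof (cases "y = w")
    case True
    then show ?thesis
      using tail[OF _ rewrite_refl] s(1) by metis
  next
    case False
    with y(2) obtain \<alpha> r r' \<beta>
      where r: "(r, r') \<in> R \<union> R\<inverse>" "q\<^sub>0 @ s = \<alpha> @ r @ \<beta>" "w = \<alpha> @ r' @ \<beta>"
      unfolding rewrite_def s(1) by blast
    have rF: "r \<in> Field R" and rlong: "3 * p < length r"
      using in_Field[OF r(1)] long by auto
    from r(2) obtain us where "q\<^sub>0 = \<alpha> @ us \<and> us @ s = r @ \<beta> \<or> q\<^sub>0 @ us = \<alpha> \<and> s = us @ r @ \<beta>"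
      unfolding append_eq_append_conv2 by blast
    then consider us where "\<alpha> = q\<^sub>0 @ us" "s = us @ r @ \<beta>"
      | us where "us \<noteq> []" "q\<^sub>0 = \<alpha> @ us" "us @ s = r @ \<beta>"
      by (cases "us = []") auto
    then show ?thesis
    proof cases
      case 1
      have "rewrite R s (us @ r' @ \<beta>)"
        unfolding rewrite_def 1(2) using r(1) by blast
      then show ?thesis
        using tail r(3) 1 by simp
    next
      case 2
      \<comment> \<open>If \<open>r\<close> shared \<open>p\<close> letters with
        \<open>q\<^sub>0\<close>, its prefix would occur in \<open>v\<close> away from the start,
        since \<open>x\<close> is nonempty.\<close>
      have "length us < p"
      proof (rule ccontr)
        assume "\<not> length us < p"
        then have "take p us = take p r"
          using arg_cong[OF 2(3), of "take p"] rlong by simp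
        then have "v = (x @ \<alpha>) @ take p r @ (drop p us @ q\<^sub>1)"
          using Suc.prems(2) 2(2) by (metis append.assoc append_take_drop_id)
        then show False
          using relation_word_not_proper_factor[OF Suc.prems(1) rF] Suc.prems(3) by blast
      qed
      with 2(3) rlong obtain r2 where r2: "r = us @ r2" "s = r2 @ \<beta>"
        by (auto simp: append_eq_append_conv2)
      define r20 where "r20 = take (length r2 - p) r2"
      define r21 where "r21 = drop (length r2 - p) r2"
      have len: "length r2 > 2 * p" "length r21 = p" "length r20 \<ge> p" "r2 = r20 @ r21"
        using r2(1) rlong \<open>length us < p\<close> by (auto simp: r20_def r21_def)
      have "(rewrite R ^^ n) (r20 @ r21 @ \<beta>) (q\<^sub>1 @ t)"
        using rewrites_sym[OF s(2)] r2(2) len(4) by simp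
      then obtain s2 where "q\<^sub>1 @ t = r20 @ s2"
        using Suc.IH[OF rF _ 2(1) len(2)] r2(1) len(4) by blast
      then obtain z where "r20 = q\<^sub>1 @ z"
        using len(3) Suc.prems(4) by (auto simp: append_eq_append_conv2)
      then have "r = us @ q\<^sub>1 @ (z @ r21)"
        using r2(1) len(4) by simp
      moreover have "v = (x @ q\<^sub>0) @ q\<^sub>1 @ []"
        using Suc.prems(2) by simp
      \<comment> \<open>Uniqueness puts both occurrences of \<open>q\<^sub>1\<close> at the same
        position, yet \<open>us\<close> is a suffix of \<open>q\<^sub>0\<close> and \<open>x\<close>
        is nonempty, so \<open>x @ q\<^sub>0\<close> is longer than \<open>us\<close>.\<close>
      ultimately have "x @ q\<^sub>0 = us"
        using factor_unique[OF Suc.prems(1) rF] Suc.prems(4) by blast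
      then have False
        using 2(2) Suc.prems(3) by (auto dest: arg_cong[of _ _ length])
      then show ?thesis ..
    qed
  qed
qed

lemma rewrite_Cons_cases:
  assumes "rewrite R (c # s) w"
  obtains (tail) s' where "w = c # s'" "rewrite R s s'"
    | (head) v b u t where "(c # v, b # u) \<in> R \<union> R\<inverse>" "s = v @ t" "w = b # u @ t"
proof (cases "c # s = w")
  case False
  with assms obtain x r r' y where r: "(r, r') \<in> R \<union> R\<inverse>" "c # s = x @ r @ y" "w = x @ r' @ y"
    unfolding rewrite_def by blast
  show ?thesis
  proof (cases x)
    case Nil
    have "r \<noteq> []" "r' \<noteq> []"
      using in_Field[OF r(1)] long by fastforce+
    then obtain v b u where "r = c # v" "r' = b # u"
      using r(2) Nil by (metis append_Cons append_Nil list.exhaust list.inject)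
    then show ?thesis
      using head r Nil by auto
  next
    case (Cons d x')
    have "rewrite R s (x' @ r' @ y)"
      using r Cons unfolding rewrite_def by auto
    then show ?thesis
      using tail r Cons by auto
  qed
qed (use tail in auto)

text \<open>Cancelling a letter never lengthens a chain; this makes the strong induction on the length of
  the chain go through.\<close>

lemma rewrites_Cons:
  assumes heads: "\<And>u v. (u, v) \<in> R \<Longrightarrow> hd u \<noteq> hd v"
    and "(rewrite R ^^ n) (a # s) (b # s')"
  shows "a = b \<and> (rewrite R ^^ n) s s' \<or>
    (\<exists>u v t n\<^sub>1 n\<^sub>2. (a # u, b # v) \<in> R \<union> R\<inverse> \<and> n\<^sub>1 + n\<^sub>2 < n \<and>
       (rewrite R ^^ n\<^sub>1) s (u @ t) \<and> (rewrite R ^^ n\<^sub>2) (v @ t) s')"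
  using assms(2)
proof (induction n arbitrary: a s b s' rule: less_induct)
  case (less n)
  show ?case
  proof (cases n)
    case 0
    then show ?thesis
      using less.prems by simp
  next
    case (Suc m)
    with less.prems obtain y where y: "(rewrite R ^^ m) (a # s) y" "rewrite R y (b # s')"
      by auto
    \<comment> \<open>Two words with the same first letter can only fall under the first
      alternative, because the sides of a relation start differently. Hence a common prefix cancels
      from a shorter chain without lengthening it.\<close>
    have cancel: "(rewrite R ^^ l) t t'" if "l < n" "(rewrite R ^^ l) (q @ t) (q @ t')" for l q t t'
      using that(2)
    proof (induction q)
      case (Cons d q)
      then have "(rewrite R ^^ l) (q @ t) (q @ t')"
        using less.IH[OF that(1), of d "q @ t" d "q @ t'"] heads by fastforce
      then show ?case
        using Cons.IH by blast
    qed simp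
    from rewrite_sym[OF y(2)] obtain c z where cz: "y = c # z"
      by (rule rewrite_Cons_cases) auto
    have "m < n"
      using Suc by simp
    note IH = less.IH[OF this y(1)[unfolded cz]]
    from y(2)[unfolded cz] show ?thesis
    proof (cases rule: rewrite_Cons_cases)
      case (tail z')
      then have [simp]: "c = b" and step: "rewrite R z s'"
        by auto
      from IH show ?thesis
      proof (elim disjE exE conjE)
        assume "a = c" "(rewrite R ^^ m) s z"
        then show ?thesis
          using step Suc by (auto intro: relpowp_Suc_I)
      next
        fix u v t n\<^sub>1 n\<^sub>2
        assume "(a # u, c # v) \<in> R \<union> R\<inverse>" "n\<^sub>1 + n\<^sub>2 < m" "(rewrite R ^^ n\<^sub>1) s (u @ t)"
          "(rewrite R ^^ n\<^sub>2) (v @ t) z"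
        moreover have "(rewrite R ^^ Suc n\<^sub>2) (v @ t) s'"
          using calculation step by (blast intro: relpowp_Suc_I)
        moreover have "n\<^sub>1 + Suc n\<^sub>2 < n"
          using calculation Suc by simp
        ultimately show ?thesis
          by (metis \<open>c = b\<close>)
      qed
    next
      case (head v b' u t)
      then have S: "(c # v, b # u) \<in> R \<union> R\<inverse>" "z = v @ t" "s' = u @ t"
        by auto
      from IH show ?thesis
      proof (elim disjE exE conjE)
        assume "a = c" "(rewrite R ^^ m) s z"
        \<comment> \<open>The chain up to here acts on the tails only, so the last step supplies the
          relation and no steps remain after it.\<close>
        moreover have "(rewrite R ^^ 0) (u @ t) s'" "m + 0 < n"
          using S Suc by simp_all
        ultimately show ?thesis
          using S by blast
      next
        fix u' v' t' n\<^sub>1 n\<^sub>2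
        assume H: "(a # u', c # v') \<in> R \<union> R\<inverse>" "n\<^sub>1 + n\<^sub>2 < m" "(rewrite R ^^ n\<^sub>1) s (u' @ t')"
          "(rewrite R ^^ n\<^sub>2) (v' @ t') z"
        have F: "c # v \<in> Field R" "c # v' \<in> Field R"
          using in_Field S(1) H(1) by blast+
        then have lens: "3 * p \<le> length v" "3 * p \<le> length v'"
          using long by fastforce+
        \<comment> \<open>Only the part of \<open>v'\<close> before its last \<open>p\<close>
          letters is known to survive, but it has at least \<open>2 * p\<close> letters, enough to
          recognise the word \<open>c # v\<close> rewritten in the last step.\<close>
        define q0 where "q0 = take (length v' - p) v'"
        define q1 where "q1 = drop (length v' - p) v'"
        have q: "v' = q0 @ q1" "length q1 = p" "2 * p \<le> length q0"
          using lens by (auto simp: q0_def q1_def)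
        have "(rewrite R ^^ n\<^sub>2) (q0 @ q1 @ t') z"
          using H(4) q(1) by simp
        then obtain s3 where s3: "z = q0 @ s3" "(rewrite R ^^ n\<^sub>2) (q1 @ t') s3"
          using proper_suffix_frozen[OF F(2) _ _ q(2), of "[c]" q0] q(1) by fastforce
        have "take p v = take p q0"
          using arg_cong[OF s3(1)[unfolded S(2)], of "take p"] lens q by simp
        then have "c # v = [c] @ take p q0 @ drop p v" "c # v' = [c] @ take p q0 @ (drop p q0 @ q1)"
          using q(1) by (metis append_Cons append_Nil append_take_drop_id append.assoc)+
        moreover have "length (take p q0) = p"
          using q(3) by simp
        ultimately have "c # v = c # v'"
          using factor_unique[OF F] by blast
        then have "v = v'"
          by simp
        then have "s3 = q1 @ t"
          using s3(1) S(2) q(1) by simp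
        \<comment> \<open>The last step undoes the earlier change of the first letter. Cancelling
          \<open>q1\<close> leaves \<open>n\<^sub>2\<close> steps from \<open>t'\<close> to
          \<open>t\<close>, and these can be carried out behind \<open>u'\<close>, without applying
          the relation at all.\<close>
        then have "(rewrite R ^^ n\<^sub>2) t' t"
          using cancel[of n\<^sub>2 q1 t' t] s3(2) H(2) Suc by simp
        moreover have "a # u' = b # u"
          using matching S(1) H(1) \<open>v = v'\<close> unfolding single_valued_def by blast
        moreover have "(rewrite R ^^ n\<^sub>2) (u' @ t') (u' @ t)"
          using rewrites_context[of n\<^sub>2 R t' t u' "[]"] calculation(1) by simp
        ultimately have "(rewrite R ^^ (n\<^sub>1 + n\<^sub>2)) s s'"
          using rewrites_trans[OF H(3)] S(3) by simp
        then have "(rewrite R ^^ n) s s'"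
          by (rule rewrites_mono) (use H(2) Suc in simp)
        then show ?thesis
          using \<open>a # u' = b # u\<close> by simp
      qed
    qed
  qed
qed

lemma left_cancellative_if_heads_differ:
  assumes "is_presentation A R" and heads: "\<And>u v. (u, v) \<in> R \<Longrightarrow> hd u \<noteq> hd v"
  shows "left_cancellative_pres A R"
  unfolding left_cancellative_pres_def
proof (intro ballI impI)
  fix x y z
  assume "x \<in> lists A" "y \<in> lists A" "pres_cong A R (x @ y) (x @ z)"
  then obtain n where "(rewrite R ^^ n) (x @ y) (x @ z)"
    using pres_cong_imp_rewrites by blast
  then have "(rewrite R ^^ n) y z"
  proof (induction x)
    case (Cons d x)
    then have "(rewrite R ^^ n) (x @ y) (x @ z)"
      using rewrites_Cons[OF heads, of n d "x @ y" d "x @ z"] heads by fastforce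
    then show ?case
      using Cons.IH by blast
  qed simp
  then show "pres_cong A R y z"
    using rewrites_imp_pres_cong assms(1) \<open>y \<in> lists A\<close> by blast
qed

lemma heads_differ_if_left_cancellative:
  assumes "is_presentation A R" "left_cancellative_pres A R" "(u, v) \<in> R"
  shows "hd u \<noteq> hd v"
proof
  assume "hd u = hd v"
  have F: "u \<in> Field R" "v \<in> Field R"
    using in_Field assms(3) by blast+
  then have "u \<noteq> []" "v \<noteq> []"
    using long by fastforce+
  with \<open>hd u = hd v\<close> obtain a u' v' where uv: "u = a # u'" "v = a # v'"
    by (metis list.collapse)
  have "[a] \<in> lists A" "u' \<in> lists A" "v' \<in> lists A"
    using assms(1,3) uv by (auto simp: is_presentation_def)
  moreover have "pres_cong A R ([a] @ u') ([a] @ v')"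
    using assms(3) uv by (auto intro: pres_cong.base)
  ultimately have "pres_cong A R u' v'"
    using assms(2) unfolding left_cancellative_pres_def by blast
  then obtain n where n: "(rewrite R ^^ n) u' v'"
    using pres_cong_imp_rewrites by blast
  \<comment> \<open>A relation word inside \<open>u'\<close> would occur in \<open>u\<close> behind
    its first letter, so \<open>u'\<close> admits only identity steps.\<close>
  have "w = u'" if "rewrite R u' w" for w
  proof (rule ccontr)
    assume "w \<noteq> u'"
    with that obtain x r r' y where r: "(r, r') \<in> R \<union> R\<inverse>" "u' = x @ r @ y"
      unfolding rewrite_def by blast
    then have "u = (a # x) @ take p r @ (drop p r @ y)"
      using uv by simp
    then show False
      using relation_word_not_proper_factor[OF F(1)] in_Field[OF r(1)] by blast
  qed
  then have "(rewrite R ^^ n) u' w \<Longrightarrow> w = u'" for w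
    by (induction n arbitrary: w) auto
  with n uv assms(3) irreflexive show False
    by blast
qed

lemma left_cancellative_iff:
  assumes "is_presentation A R"
  shows "left_cancellative_pres A R \<longleftrightarrow> (\<forall>(u, v)\<in>R. hd u \<noteq> hd v)"
  using left_cancellative_if_heads_differ[OF assms] heads_differ_if_left_cancellative[OF assms]
  by blast

end

section \<open>Reversal and right cancellativity\<close>

abbreviation rev_pres :: "('a list \<times> 'a list) set \<Rightarrow> ('a list \<times> 'a list) set" where
  "rev_pres R \<equiv> map_prod rev rev ` R"

lemma rev_pres_rev_pres: "rev_pres (rev_pres R) = R"
  by (force simp: image_image)

lemma mem_rev_pres: "(u, v) \<in> rev_pres R \<longleftrightarrow> (rev u, rev v) \<in> R"
  by force

lemma pres_cong_rev:
  "pres_cong A R u v \<Longrightarrow> pres_cong A (rev_pres R) (rev u) (rev v)"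
proof (induction rule: pres_cong.induct)
  case (compat u v x y)
  then have "rev x \<in> lists A" "rev y \<in> lists A"
    by auto
  then show ?case
    using pres_cong.compat[OF compat.IH, of "rev y" "rev x"] by simp
qed (auto intro: pres_cong.intros simp: mem_rev_pres)

lemma pres_cong_rev_iff:
  "pres_cong A (rev_pres R) u v \<longleftrightarrow> pres_cong A R (rev u) (rev v)"
  using pres_cong_rev[of A "rev_pres R" u v] pres_cong_rev[of A R "rev u" "rev v"]
  by (auto simp: rev_pres_rev_pres)

lemma right_cancellative_iff_rev:
  "right_cancellative_pres A R \<longleftrightarrow> left_cancellative_pres A (rev_pres R)"
proof
  assume R: "right_cancellative_pres A R"
  show "left_cancellative_pres A (rev_pres R)"
    unfolding left_cancellative_pres_def pres_cong_rev_iff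
  proof (intro ballI impI)
    fix x y z
    assume "x \<in> lists A" "y \<in> lists A" "z \<in> lists A" "pres_cong A R (rev (x @ y)) (rev (x @ z))"
    then have "rev x \<in> lists A" "rev y \<in> lists A" "rev z \<in> lists A"
        "pres_cong A R (rev y @ rev x) (rev z @ rev x)"
      by auto
    then show "pres_cong A R (rev y) (rev z)"
      using R unfolding right_cancellative_pres_def by blast
  qed
next
  assume L: "left_cancellative_pres A (rev_pres R)"
  show "right_cancellative_pres A R"
    unfolding right_cancellative_pres_def
  proof (intro ballI impI)
    fix x y z
    assume "x \<in> lists A" "y \<in> lists A" "z \<in> lists A" "pres_cong A R (y @ x) (z @ x)"
    then have "rev x \<in> lists A" "rev y \<in> lists A" "rev z \<in> lists A"
        "pres_cong A (rev_pres R) (rev x @ rev y) (rev x @ rev z)"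
      by (auto simp: pres_cong_rev_iff)
    then have "pres_cong A (rev_pres R) (rev y) (rev z)"
      using L unfolding left_cancellative_pres_def by blast
    then show "pres_cong A R y z"
      by (simp add: pres_cong_rev_iff)
  qed
qed

lemma Field_rev_pres: "w \<in> Field (rev_pres R) \<longleftrightarrow> rev w \<in> Field R"
  by (metis Field_iff mem_rev_pres rev_rev_ident)

lemma small_overlap_rev:
  assumes "small_overlap R p"
  shows "small_overlap (rev_pres R) p"
proof -
  interpret small_overlap R p by fact
  show ?thesis
  proof
    show "(u, u) \<notin> rev_pres R" for u
      using irreflexive by (simp add: mem_rev_pres)
    show "single_valued (rev_pres R \<union> (rev_pres R)\<inverse>)"
      using matching unfolding single_valued_def
      by (metis (no_types, lifting) Un_iff converse_iff mem_rev_pres rev_rev_ident)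
    show "3 * p < length w" if "w \<in> Field (rev_pres R)" for w
      using long[of "rev w"] that by (simp add: Field_rev_pres)
    fix u v x q y x' y' :: "'a list"
    assume *: "u \<in> Field (rev_pres R)" "v \<in> Field (rev_pres R)" "u = x @ q @ y" "v = x' @ q @ y'"
      "length q = p"
    \<comment> \<open>Reversal exchanges what precedes and what follows \<open>q\<close>, so
      uniqueness yields \<open>y = y'\<close>; then \<open>x = x'\<close> follows by cancelling in
      \<open>u = v\<close>.\<close>
    have "rev u = rev v \<and> rev y = rev y'"
      by (rule factor_unique[of _ _ _ "rev q" "rev x" _ "rev x'"]) (use * in \<open>simp_all add: Field_rev_pres\<close>)
    then have "u = v" "y = y'"
      by simp_all
    then show "u = v \<and> x = x'"
      using *(3,4) by (metis append_same_eq)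
  qed
qed

lemma (in small_overlap) right_cancellative_iff:
  assumes "is_presentation A R"
  shows "right_cancellative_pres A R \<longleftrightarrow> (\<forall>(u, v)\<in>R. last u \<noteq> last v)"
proof -
  interpret rev: small_overlap "rev_pres R" p
    using small_overlap_rev small_overlap_axioms by blast
  have ne: "u \<noteq> [] \<and> v \<noteq> []" if "(u, v) \<in> R" for u v
    using in_Field[of u v] long that by fastforce
  have "is_presentation A (rev_pres R)"
    using assms by (auto simp: is_presentation_def)
  then have "right_cancellative_pres A R \<longleftrightarrow> (\<forall>(u, v)\<in>rev_pres R. hd u \<noteq> hd v)"
    unfolding right_cancellative_iff_rev by (rule rev.left_cancellative_iff)
  also have "\<dots> \<longleftrightarrow> (\<forall>(u, v)\<in>R. last u \<noteq> last v)"
    by (fastforce simp: hd_rev dest: ne)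
  finally show ?thesis .
qed

section \<open>Words without repeated factors\<close>

definition words :: "'a set \<Rightarrow> nat \<Rightarrow> 'a list set" where
  "words A l = {w \<in> lists A. length w = l}"

lemma words_altdef: "words A l = {w. set w \<subseteq> A \<and> length w = l}"
  by (auto simp: words_def)

lemma finite_words: "finite A \<Longrightarrow> finite (words A l)"
  by (simp add: words_altdef finite_lists_length_eq)

lemma card_words: "finite A \<Longrightarrow> card (words A l) = card A ^ l"
  by (simp add: words_altdef card_lists_length_eq)

definition repeat_free :: "nat \<Rightarrow> 'a list \<Rightarrow> bool" where
  "repeat_free p w \<longleftrightarrow>
     (\<forall>g h. g < h \<and> h + p \<le> length w \<longrightarrow> take p (drop g w) \<noteq> take p (drop h w))"

text \<open>The later occurrence can be deleted: its letters are read off one after the other from the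
  earlier one, even if the two overlap.\<close>

lemma inj_on_delete_repeat:
  assumes "g < h"
  shows "inj_on (\<lambda>w. take h w @ drop (h + p) w)
    {w \<in> words A N. h + p \<le> N \<and> take p (drop g w) = take p (drop h w)}"
proof (rule inj_onI)
  fix w w' :: "'a list"
  assume w: "w \<in> {w \<in> words A N. h + p \<le> N \<and> take p (drop g w) = take p (drop h w)}"
    and w': "w' \<in> {w \<in> words A N. h + p \<le> N \<and> take p (drop g w) = take p (drop h w)}"
    and "take h w @ drop (h + p) w = take h w' @ drop (h + p) w'"
  then have len: "length w = N" "length w' = N" "h + p \<le> N"
    and eq: "take h w = take h w'" "drop (h + p) w = drop (h + p) w'"
    by (auto simp: words_def)
  have shift: "v ! i = v ! (g + (i - h))"
    if "length v = N" "take p (drop g v) = take p (drop h v)" "h \<le> i" "i < h + p" for v :: "'a list" and i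
  proof -
    have "take p (drop g v) ! (i - h) = take p (drop h v) ! (i - h)"
      using that(2) by simp
    moreover have "i - h < p" "g + (i - h) < N" "h + (i - h) = i"
      using that len(3) assms by linarith+
    ultimately show ?thesis
      using that(1) len(3) assms by simp
  qed
  have "w ! i = w' ! i" if "i < N" for i
    using that
  proof (induction i rule: less_induct)
    case (less i)
    consider "i < h" | "h \<le> i" "i < h + p" | "h + p \<le> i"
      by linarith
    then show ?case
    proof cases
      case 1
      then show ?thesis
        using arg_cong[OF eq(1), of "\<lambda>xs. xs ! i"] by simp
    next
      case 2
      then show ?thesis
        using shift[of w i] shift[of w' i] w w' len less.IH[of "g + (i - h)"] less.prems assms by simp
    next
      case 3
      then show ?thesis
        using arg_cong[OF eq(2), of "\<lambda>xs. xs ! (i - (h + p))"] len less.prems by simp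
    qed
  qed
  then show "w = w'"
    using len by (intro nth_equalityI) simp_all
qed

text \<open>Union bound: there are at most \<open>N ^ 2\<close> pairs of positions, and by
  \<open>inj_on_delete_repeat\<close> at most \<open>card A ^ (N - p)\<close> words repeat a factor
  at a given pair.\<close>

lemma card_not_repeat_free_le:
  assumes "finite A" "card A > 0" "p > 0"
  shows "real (card {w \<in> words A N. \<not> repeat_free p w})
    \<le> real N ^ 2 * real (card A) ^ N / real (card A) ^ p"
proof (cases "N < p")
  case True
  then have "{w \<in> words A N. \<not> repeat_free p w} = {}"
    by (auto simp: repeat_free_def words_def)
  then show ?thesis
    by (simp only: card.empty) simp
next
  case False
  let ?B = "\<lambda>(g, h). if g < h then {w \<in> words A N. h + p \<le> N \<and> take p (drop g w) = take p (drop h w)} else {}"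
  let ?I = "{..<N} \<times> {..<N}"
  have "{w \<in> words A N. \<not> repeat_free p w} \<subseteq> (\<Union>i\<in>?I. ?B i)"
  proof
    fix w assume "w \<in> {w \<in> words A N. \<not> repeat_free p w}"
    then obtain g h where "w \<in> words A N" "g < h" "h + p \<le> N" "take p (drop g w) = take p (drop h w)"
      by (auto simp: repeat_free_def words_def)
    \<comment> \<open>Since \<open>p > 0\<close>, an occurrence that fits into the word starts
      before position \<open>N\<close>.\<close>
    then have "w \<in> ?B (g, h)" "(g, h) \<in> ?I"
      using assms(3) by auto
    then show "w \<in> (\<Union>i\<in>?I. ?B i)"
      by blast
  qed
  moreover have "finite (\<Union>i\<in>?I. ?B i)"
    by (rule finite_subset[OF _ finite_words[OF assms(1), of N]]) (auto split: if_splits)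
  ultimately have "card {w \<in> words A N. \<not> repeat_free p w} \<le> card (\<Union>i\<in>?I. ?B i)"
    by (rule card_mono[rotated])
  also have "\<dots> \<le> (\<Sum>i\<in>?I. card (?B i))"
    by (rule card_UN_le) simp
  also have "\<dots> \<le> (\<Sum>i\<in>?I. card A ^ (N - p))"
  proof (rule sum_mono)
    fix i :: "nat \<times> nat"
    obtain g h where [simp]: "i = (g, h)"
      by force
    show "card (?B i) \<le> card A ^ (N - p)"
    proof (cases "g < h")
      case True
      then have "card (?B i) = card ((\<lambda>w. take h w @ drop (h + p) w) ` ?B i)"
        using inj_on_delete_repeat[OF True, of p A N] by (simp add: card_image)
      also have "\<dots> \<le> card (words A (N - p))"
        using assms(1) set_take_subset set_drop_subset
        by (intro card_mono finite_words) (fastforce simp: words_altdef split: if_splits)+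
      finally show ?thesis
        by (simp add: card_words assms(1))
    qed simp
  qed
  also have "\<dots> = N ^ 2 * card A ^ (N - p)"
    by (simp add: power2_eq_square)
  finally have "real (card {w \<in> words A N. \<not> repeat_free p w}) \<le> real N ^ 2 * real (card A) ^ (N - p)"
    by (metis of_nat_le_iff of_nat_mult of_nat_power)
  moreover have "real (card A) ^ (N - p) = real (card A) ^ N / real (card A) ^ p"
    using False assms(2) by (intro power_diff) auto
  ultimately show ?thesis
    by simp
qed

text \<open>Each occurrence of \<open>q\<close> in a word of \<open>ws\<close> has a position in the
  concatenation. Equal factors force equal positions, and a position determines the word of the list
  and the place within it.\<close>

lemma repeat_free_concat_factor_unique:
  assumes "repeat_free p (concat ws)" "p > 0" "i < length ws" "j < length ws"
    and "ws ! i = x @ q @ y" "ws ! j = x' @ q @ y'" "length q = p"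
  shows "i = j \<and> x = x'"
proof -
  define pos where "pos i x = length (concat (take i ws)) + length x" for i and x :: "'a list"
  have occ: "take p (drop (pos i x) (concat ws)) = q" "pos i x + p \<le> length (concat ws)"
    if "i < length ws" "ws ! i = x @ q @ y" for i x y
  proof -
    have "concat ws = concat (take i ws) @ ws ! i @ concat (drop (Suc i) ws)"
      by (metis that(1) id_take_nth_drop concat.simps(2) concat_append)
    then have "concat ws = (concat (take i ws) @ x) @ q @ (y @ concat (drop (Suc i) ws))"
      using that(2) by simp
    moreover have "pos i x = length (concat (take i ws) @ x)"
      by (simp add: pos_def)
    ultimately show "take p (drop (pos i x) (concat ws)) = q" "pos i x + p \<le> length (concat ws)"
      using assms(7) by (simp_all only: append_eq_conv_conj length_append) auto
  qed
  \<comment> \<open>The inequality is strict even for empty \<open>x'\<close>: the occurrence in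
    word \<open>i\<close> has length \<open>p > 0\<close> and ends no later than word
    \<open>j\<close> begins.\<close>
  have pos_less: "pos i x < pos j x'" if "i < j" "i < length ws" "ws ! i = x @ q @ y" for i j x x' y
  proof -
    have "take j ws = take (Suc i) ws @ drop (Suc i) (take j ws)"
      using that(1) by (metis append_take_drop_id min.absorb1 Suc_leI take_take)
    then have "length (concat (take j ws)) \<ge> length (concat (take (Suc i) ws))"
      by (metis concat_append le_add1 length_append)
    then show ?thesis
      using that assms(2,7) by (simp add: pos_def take_Suc_conv_app_nth)
  qed
  have "pos i x = pos j x'"
    using assms(1) occ[OF assms(3,5)] occ[OF assms(4,6)] unfolding repeat_free_def
    by (metis linorder_neqE_nat)
  then have "i = j"
    using pos_less[OF _ assms(3,5), of j x'] pos_less[OF _ assms(4,6), of i x]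
    by (metis linorder_neqE_nat nat_neq_iff)
  then show ?thesis
    using \<open>pos i x = pos j x'\<close> assms(5,6) by (auto simp: pos_def append_eq_append_conv)
qed

section \<open>Tuples of relations of given lengths\<close>

text \<open>Polymorphic on purpose: it serves for the sides of a tuple of relations and equally for
  the list of their length pairs.\<close>

fun flat :: "('b \<times> 'b) list \<Rightarrow> 'b list" where
  "flat [] = []"
| "flat ((x, y) # ps) = x # y # flat ps"

lemma flat_map: "flat (map (map_prod f f) ps) = map f (flat ps)"
  by (induction ps rule: flat.induct) auto

lemma set_flat: "set (flat ps) = Field (set ps)"
  by (induction ps rule: flat.induct) (auto simp: Field_def)

lemma length_flat: "length (flat ps) = 2 * length ps"
  by (induction ps rule: flat.induct) auto

lemma flat_inj: "flat ps = flat qs \<longleftrightarrow> ps = qs"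
proof (induction ps arbitrary: qs rule: flat.induct)
  case 1
  then show ?case
    by (cases qs rule: flat.cases) auto
next
  case (2 x y ps)
  then show ?case
    by (cases qs rule: flat.cases) auto
qed

lemma flat_surj: "length xs = 2 * k \<Longrightarrow> \<exists>ps. length ps = k \<and> flat ps = xs"
proof (induction k arbitrary: xs)
  case (Suc k)
  then obtain x y ys where xs: "xs = x # y # ys" "length ys = 2 * k"
    by (auto simp: length_Suc_conv)
  then obtain ps where "length ps = k" "flat ps = ys"
    using Suc.IH by blast
  then show ?case
    using xs(1) by (intro exI[of _ "(x, y) # ps"]) simp
qed simp

lemma bij_betw_flat:
  "bij_betw flat {ps. length ps = k \<and> \<Phi> (flat ps)} {xs. length xs = 2 * k \<and> \<Phi> xs}"
proof (rule bij_betw_imageI)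
  show "inj_on flat {ps. length ps = k \<and> \<Phi> (flat ps)}"
    by (simp add: inj_on_def flat_inj)
  show "flat ` {ps. length ps = k \<and> \<Phi> (flat ps)} = {xs. length xs = 2 * k \<and> \<Phi> xs}"
    using flat_surj[of _ k] by (fastforce simp: length_flat image_iff)
qed

text \<open>Without a repeated entry, every word lies in one pair and on one side only, so it
  determines its partner.\<close>

lemma distinct_flatD:
  assumes "distinct (flat ps)"
  shows "distinct ps" "(u, u) \<notin> set ps" "single_valued (set ps \<union> (set ps)\<inverse>)"
proof -
  have "distinct ps \<and> (\<forall>u. (u, u) \<notin> set ps) \<and> single_valued (set ps \<union> (set ps)\<inverse>)"
    using assms
  proof (induction ps rule: flat.induct)
    case (2 x y ps)
    then have "x \<notin> Field (set ps)" "y \<notin> Field (set ps)" "x \<noteq> y" "distinct (flat ps)"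
      by (auto simp: set_flat)
    with "2.IH" show ?case
      by (auto simp: single_valued_def Field_def)
  qed auto
  then show "distinct ps" "(u, u) \<notin> set ps" "single_valued (set ps \<union> (set ps)\<inverse>)"
    by blast+
qed

text \<open>One condition on the concatenation covers repeats within a side and between different
  sides at once. Two equal sides would repeat their first \<open>p\<close> letters, so all sides are
  distinct, which gives irreflexivity and \<open>matching\<close>.\<close>

lemma small_overlap_if_repeat_free:
  assumes "repeat_free p (concat (flat ps))" "p > 0" "\<And>w. w \<in> set (flat ps) \<Longrightarrow> 3 * p < length w"
  shows "distinct ps \<and> small_overlap (set ps) p"
proof -
  have "distinct (flat ps)"
  proof (rule ccontr)
    assume "\<not> distinct (flat ps)"
    then obtain i j where ij: "i < length (flat ps)" "j < length (flat ps)" "i \<noteq> j"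
        "flat ps ! i = flat ps ! j"
      by (auto simp: distinct_conv_nth)
    define w where "w = flat ps ! i"
    have "flat ps ! i = [] @ take p w @ drop p w" "flat ps ! j = [] @ take p w @ drop p w"
      using ij by (simp_all add: w_def)
    moreover have "length (take p w) = p"
      using assms(3)[of w] ij by (simp add: w_def)
    ultimately show False
      using repeat_free_concat_factor_unique[OF assms(1,2) ij(1,2)] ij(3) by blast
  qed
  note dist = distinct_flatD[OF this]
  have "small_overlap (set ps) p"
  proof
    show "3 * p < length w" if "w \<in> Field (set ps)" for w
      using that assms(3) by (simp add: set_flat)
    fix u v x q y x' y'
    assume "u \<in> Field (set ps)" "v \<in> Field (set ps)" and
      *: "u = x @ q @ y" "v = x' @ q @ y'" "length q = p"
    then obtain i j where ij: "i < length (flat ps)" "j < length (flat ps)"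
        "flat ps ! i = u" "flat ps ! j = v"
      by (metis in_set_conv_nth set_flat)
    then have "i = j \<and> x = x'"
      using repeat_free_concat_factor_unique[OF assms(1,2) ij(1,2)] * by blast
    then show "u = v \<and> x = x'"
      using ij by blast
  qed (use dist in auto)
  then show ?thesis
    using dist by blast
qed

section \<open>Counting tuples with given side lengths\<close>

definition shape :: "('a list \<times> 'a list) list \<Rightarrow> (nat \<times> nat) list" where
  "shape ps = map (map_prod length length) ps"

lemma flat_shape: "flat (shape ps) = map length (flat ps)"
  by (simp add: shape_def flat_map)

lemma length_shape [simp]: "length (shape ps) = length ps"
  by (simp add: shape_def)

text \<open>Relations are ordered and may repeat, so that for a fixed shape all letters are free and
  counts become powers of \<open>card A\<close>.\<close>

definition tuples :: "'a set \<Rightarrow> (nat \<times> nat) list set \<Rightarrow> ('a list \<times> 'a list) list set" where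
  "tuples A Sh = {ps. set ps \<subseteq> lists A \<times> lists A \<and> shape ps \<in> Sh}"

lemma tuples_flat_lists: "ps \<in> tuples A Sh \<Longrightarrow> set (concat (flat ps)) \<subseteq> A"
  by (fastforce simp: tuples_def set_flat Field_def)

lemma length_concat_flat: "length (concat (flat ps)) = sum_list (flat (shape ps))"
  by (simp add: flat_shape length_concat)

lemma tuples_Cons:
  "{ps \<in> tuples A {s # ls}. \<forall>r\<in>set ps. Q r} =
    (\<lambda>(r, ps). r # ps) ` ({r \<in> words A (fst s) \<times> words A (snd s). Q r} \<times>
      {ps \<in> tuples A {ls}. \<forall>r\<in>set ps. Q r})"
  (is "?L = ?f ` ?R")
proof (intro equalityI subsetI)
  fix ps assume ps: "ps \<in> ?L"
  then obtain r qs where "ps = r # qs" "map_prod length length r = s" "shape qs = ls"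
    by (auto simp: tuples_def shape_def)
  moreover from this have "r \<in> words A (fst s) \<times> words A (snd s)"
    using ps by (cases r) (auto simp: tuples_def words_def)
  ultimately show "ps \<in> ?f ` ?R"
    using ps by (intro image_eqI[of _ _ "(r, qs)"]) (simp_all add: tuples_def)
next
  fix ps assume "ps \<in> ?f ` ?R"
  then show "ps \<in> ?L"
    by (clarsimp simp: tuples_def shape_def words_def) (auto simp: in_listsI)
qed

lemma finite_tuples_singleton:
  assumes "finite A"
  shows "finite (tuples A {ls})"
proof (induction ls)
  case Nil
  then show ?case
    by (simp add: tuples_def shape_def cong: conj_cong)
next
  case (Cons s ls)
  have "finite {ps \<in> tuples A {s # ls}. \<forall>r\<in>set ps. True}"
    unfolding tuples_Cons using Cons finite_words[OF assms] by auto
  then show ?case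
    by simp
qed

text \<open>For a fixed shape the relations are chosen independently, and each passes the test with
  probability \<open>c\<close>.\<close>

lemma card_tuples_filter:
  assumes "finite A"
    and "\<And>s. s \<in> set ls \<Longrightarrow> real (card {r \<in> words A (fst s) \<times> words A (snd s). Q r})
      = c * real (card A) ^ (fst s + snd s)"
  shows "real (card {ps \<in> tuples A {ls}. \<forall>r\<in>set ps. Q r})
    = c ^ length ls * real (card A) ^ sum_list (flat ls)"
  using assms(2)
proof (induction ls)
  case Nil
  have "{ps \<in> tuples A {[]}. \<forall>r\<in>set ps. Q r} = {[]}"
    by (auto simp: tuples_def shape_def)
  then show ?case
    by simp
next
  case (Cons s ls)
  have "inj_on (\<lambda>(r, ps). r # ps) X" for X :: "(('a list \<times> 'a list) \<times> ('a list \<times> 'a list) list) set"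
    by (auto simp: inj_on_def)
  then have "real (card {ps \<in> tuples A {s # ls}. \<forall>r\<in>set ps. Q r}) =
      real (card {r \<in> words A (fst s) \<times> words A (snd s). Q r}) *
      real (card {ps \<in> tuples A {ls}. \<forall>r\<in>set ps. Q r})"
    unfolding tuples_Cons by (simp add: card_image card_cartesian_product)
  also have "\<dots> = c ^ length (s # ls) * real (card A) ^ sum_list (flat (s # ls))"
    using Cons.IH Cons.prems[of s] Cons.prems by (cases s) (simp add: power_add)
  finally show ?case .
qed

lemma card_tuples_singleton:
  assumes "finite A"
  shows "card (tuples A {ls}) = card A ^ sum_list (flat ls)"
proof -
  have "real (card {ps \<in> tuples A {ls}. \<forall>r\<in>set ps. True}) = 1 ^ length ls * real (card A) ^ sum_list (flat ls)"
    using assms by (intro card_tuples_filter)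
      (simp_all add: card_cartesian_product card_words power_add)
  then show ?thesis
    by (metis (no_types, lifting) Collect_cong Collect_mem_eq mult_1 of_nat_eq_iff of_nat_power power_one)
qed

text \<open>A fixed shape tells where to cut, so \<open>concat (flat ps)\<close> determines
  \<open>ps\<close> and the bound for single words applies.\<close>

lemma card_tuples_not_repeat_free_le:
  assumes "finite A" "card A > 0" "p > 0"
  shows "real (card {ps \<in> tuples A {ls}. \<not> repeat_free p (concat (flat ps))})
    \<le> real (sum_list (flat ls)) ^ 2 / real (card A) ^ p * real (card (tuples A {ls}))"
proof -
  let ?N = "sum_list (flat ls)"
  let ?X = "{ps \<in> tuples A {ls}. \<not> repeat_free p (concat (flat ps))}"
  have "inj_on (\<lambda>ps. concat (flat ps)) ?X"
  proof (rule inj_onI)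
    fix ps qs assume *: "ps \<in> ?X" "qs \<in> ?X" "concat (flat ps) = concat (flat qs)"
    then have len: "map length (flat ps) = map length (flat qs)"
      by (auto simp: tuples_def simp flip: flat_shape)
    then have "length (flat ps) = length (flat qs)"
      by (metis length_map)
    moreover have "\<forall>(x, y)\<in>set (zip (flat ps) (flat qs)). length x = length y"
      using len by (auto simp: set_zip) (metis nth_map)
    ultimately have "flat ps = flat qs"
      using *(3) concat_eq_concat_iff by blast
    then show "ps = qs"
      by (simp add: flat_inj)
  qed
  then have "card ?X = card ((\<lambda>ps. concat (flat ps)) ` ?X)"
    by (simp add: card_image)
  also have "\<dots> \<le> card {w \<in> words A ?N. \<not> repeat_free p w}"
  proof (rule card_mono)
    show "finite {w \<in> words A ?N. \<not> repeat_free p w}"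
      using finite_words[OF assms(1)] by simp
    show "(\<lambda>ps. concat (flat ps)) ` ?X \<subseteq> {w \<in> words A ?N. \<not> repeat_free p w}"
    proof (rule image_subsetI)
      fix ps assume "ps \<in> ?X"
      moreover from this have "shape ps = ls"
        by (simp add: tuples_def)
      ultimately show "concat (flat ps) \<in> {w \<in> words A ?N. \<not> repeat_free p w}"
        using tuples_flat_lists[of ps A "{ls}"] length_concat_flat[of ps] by (simp add: words_altdef)
    qed
  qed
  finally have "real (card ?X) \<le> real (card {w \<in> words A ?N. \<not> repeat_free p w})"
    by simp
  also note card_not_repeat_free_le[OF assms]
  finally show ?thesis
    by (simp add: card_tuples_singleton[OF assms(1)])
qed

lemma tuples_UN: "{ps \<in> tuples A Sh. \<Phi> ps} = (\<Union>ls\<in>Sh. {ps \<in> tuples A {ls}. \<Phi> ps})"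
  by (auto simp: tuples_def)

lemma tuples_restrict: "tuples A {ls \<in> Sh. \<Phi> ls} = {ps \<in> tuples A Sh. \<Phi> (shape ps)}"
  unfolding tuples_def by blast

lemma finite_tuples: "finite A \<Longrightarrow> finite Sh \<Longrightarrow> finite (tuples A Sh)"
  using tuples_UN[of A Sh "\<lambda>_. True"] finite_tuples_singleton by auto

lemma card_tuples_eq_sum:
  assumes "finite A" "finite Sh"
  shows "card {ps \<in> tuples A Sh. \<Phi> ps} = (\<Sum>ls\<in>Sh. card {ps \<in> tuples A {ls}. \<Phi> ps})"
  unfolding tuples_UN[of A Sh]
proof (rule card_UN_disjoint)
  show "\<forall>ls\<in>Sh. finite {ps \<in> tuples A {ls}. \<Phi> ps}"
    using finite_tuples_singleton[OF assms(1)] by simp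
  show "\<forall>ls\<in>Sh. \<forall>ls'\<in>Sh. ls \<noteq> ls' \<longrightarrow>
      {ps \<in> tuples A {ls}. \<Phi> ps} \<inter> {ps \<in> tuples A {ls'}. \<Phi> ps} = {}"
    by (auto simp: tuples_def)
qed (rule assms)

section \<open>Asymptotic proportions\<close>

lemma null_comparison:
  fixes f g :: "nat \<Rightarrow> real"
  assumes "\<forall>\<^sub>F n in sequentially. norm (f n) \<le> g n" "g \<longlonglongrightarrow> 0"
  shows "f \<longlonglongrightarrow> 0"
  by (rule tendsto_0_le[OF assms(2), of _ 1]) (use assms(1) in eventually_elim, simp)

text \<open>The number of orderings is the same for every presentation and cancels in proportions,
  which may therefore be computed with ordered tuples.\<close>

lemma card_distinct_lists:
  assumes "finite S" "\<And>R. R \<in> S \<Longrightarrow> finite R \<and> card R = k"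
  shows "card {ps. distinct ps \<and> set ps \<in> S} = fact k * card S"
proof -
  have "{ps. distinct ps \<and> set ps \<in> S} = (\<Union>R\<in>S. permutations_of_set R)"
    by (auto simp: permutations_of_set_def)
  also have "card \<dots> = (\<Sum>R\<in>S. card (permutations_of_set R))"
    using assms(1) by (intro card_UN_disjoint) (simp_all, auto simp: permutations_of_set_def)
  also have "\<dots> = fact k * card S"
    using assms(2) by simp
  finally show ?thesis .
qed

definition is_short :: "nat \<Rightarrow> (nat \<times> nat) list \<Rightarrow> bool" where
  "is_short L ls \<longleftrightarrow> (\<exists>l\<in>set (flat ls). l < L)"

lemma card_le_card_plus_if_subset_Un:
  assumes "finite B" "X \<subseteq> Y \<union> B"
    and "finite Y"
  shows "real (card X) \<le> real (card Y) + real (card B)"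
proof -
  have "card X \<le> card (Y \<union> B)"
    using assms by (intro card_mono) auto
  also have "\<dots> \<le> card Y + card B"
    by (rule card_Un_le)
  finally show ?thesis
    by simp
qed

text \<open>For shapes without short entries the independence count is exact;
  \<open>L \<ge> 2\<close> brings them within the range of the hypothesis on \<open>Q\<close>.
  Tuples of short shape enter the error once through the count itself and once, weighted by
  \<open>c ^ k\<close>, through the main term.\<close>

lemma card_tuples_filter_estimate:
  assumes "finite A" "finite Sh" "\<And>ls. ls \<in> Sh \<Longrightarrow> length ls = k" "L \<ge> 2" "c \<ge> 0"
    and Q: "\<And>l l'. l \<ge> 2 \<Longrightarrow> l' \<ge> 2 \<Longrightarrow>
      real (card {r \<in> words A l \<times> words A l'. Q r}) = c * real (card A) ^ (l + l')"
  shows "\<bar>real (card {ps \<in> tuples A Sh. \<forall>r\<in>set ps. Q r}) - c ^ k * real (card (tuples A Sh))\<bar>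
    \<le> (1 + c ^ k) * real (card {ps \<in> tuples A Sh. is_short L (shape ps)})"
proof -
  define Sh' where "Sh' = {ls \<in> Sh. \<not> is_short L ls}"
  let ?T = "tuples A Sh" and ?T' = "tuples A Sh'"
  let ?B = "{ps \<in> ?T. is_short L (shape ps)}"
  have fin: "finite ?T" "finite Sh'" "finite ?T'"
    using finite_tuples[OF assms(1)] assms(2) by (simp_all add: Sh'_def)
  have T': "?T' = {ps \<in> ?T. \<not> is_short L (shape ps)}"
    unfolding Sh'_def by (rule tuples_restrict)
  then have T: "?T = ?T' \<union> ?B" "?T' \<inter> ?B = {}"
    by blast+
  have cT: "real (card ?T) = real (card ?T') + real (card ?B)"
    using card_Un_disjoint[OF fin(3) _ T(2)] fin(1) T(1) by (metis (no_types, lifting) finite_Un of_nat_add)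
  have "real (card {ps \<in> ?T'. \<forall>r\<in>set ps. Q r}) =
      (\<Sum>ls\<in>Sh'. real (card {ps \<in> tuples A {ls}. \<forall>r\<in>set ps. Q r}))"
    using card_tuples_eq_sum[OF assms(1) fin(2), of "\<lambda>ps. \<forall>r\<in>set ps. Q r"] by simp
  also have "\<dots> = (\<Sum>ls\<in>Sh'. c ^ k * real (card (tuples A {ls})))"
  proof (rule sum.cong)
    fix ls assume ls: "ls \<in> Sh'"
    have "real (card {r \<in> words A (fst s) \<times> words A (snd s). Q r})
        = c * real (card A) ^ (fst s + snd s)" if "s \<in> set ls" for s
    proof -
      obtain l l' where s: "s = (l, l')"
        by force
      with that have "l \<in> set (flat ls)" "l' \<in> set (flat ls)"
        by (auto simp: set_flat Field_def)
      then show ?thesis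
        using ls assms(4) Q[of l l'] s by (force simp: Sh'_def is_short_def)
    qed
    then have "real (card {ps \<in> tuples A {ls}. \<forall>r\<in>set ps. Q r}) =
        c ^ length ls * real (card A) ^ sum_list (flat ls)"
      by (intro card_tuples_filter assms(1)) auto
    also have "\<dots> = c ^ k * real (card (tuples A {ls}))"
      using ls assms(3) by (simp add: Sh'_def card_tuples_singleton[OF assms(1)])
    finally show "real (card {ps \<in> tuples A {ls}. \<forall>r\<in>set ps. Q r}) =
        c ^ k * real (card (tuples A {ls}))" .
  qed simp
  also have "\<dots> = c ^ k * real (card ?T')"
    using card_tuples_eq_sum[OF assms(1) fin(2), of "\<lambda>_. True"] by (simp add: sum_distrib_left)
  finally have Y': "real (card {ps \<in> ?T'. \<forall>r\<in>set ps. Q r}) = c ^ k * real (card ?T')" .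
  have up: "real (card {ps \<in> ?T. \<forall>r\<in>set ps. Q r}) \<le>
      real (card {ps \<in> ?T'. \<forall>r\<in>set ps. Q r}) + real (card ?B)"
    by (rule card_le_card_plus_if_subset_Un) (use fin T' in auto)
  have low: "real (card {ps \<in> ?T'. \<forall>r\<in>set ps. Q r}) \<le> real (card {ps \<in> ?T. \<forall>r\<in>set ps. Q r})"
    using fin T' by (intro of_nat_mono card_mono) auto
  have "c ^ k * real (card ?T) = c ^ k * real (card ?T') + c ^ k * real (card ?B)"
    by (simp add: cT distrib_left)
  moreover have "c ^ k * real (card ?B) \<ge> 0"
    using assms(5) by simp
  ultimately show ?thesis
    using up low Y' by (simp add: abs_le_iff distrib_right)
qed

text \<open>Estimating the total length by \<open>N\<close> and \<open>card A\<close> from below by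
  2 makes the bound uniform in the shape, so it can be summed.\<close>

lemma card_tuples_repeats_le:
  assumes "finite A" "card A \<ge> 2" "finite Sh" "\<And>ls. ls \<in> Sh \<Longrightarrow> sum_list (flat ls) \<le> N" "p > 0"
  shows "real (card {ps \<in> tuples A Sh. \<not> repeat_free p (concat (flat ps))})
    \<le> real N ^ 2 / 2 ^ p * real (card (tuples A Sh))"
proof -
  have "real (card {ps \<in> tuples A Sh. \<not> repeat_free p (concat (flat ps))}) =
      (\<Sum>ls\<in>Sh. real (card {ps \<in> tuples A {ls}. \<not> repeat_free p (concat (flat ps))}))"
    using card_tuples_eq_sum[OF assms(1,3)] by simp
  also have "\<dots> \<le> (\<Sum>ls\<in>Sh. real N ^ 2 / 2 ^ p * real (card (tuples A {ls})))"
  proof (rule sum_mono)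
    fix ls assume ls: "ls \<in> Sh"
    have "real (card {ps \<in> tuples A {ls}. \<not> repeat_free p (concat (flat ps))}) \<le>
        real (sum_list (flat ls)) ^ 2 / real (card A) ^ p * real (card (tuples A {ls}))"
      using assms by (intro card_tuples_not_repeat_free_le) auto
    also have "\<dots> \<le> real N ^ 2 / 2 ^ p * real (card (tuples A {ls}))"
    proof (rule mult_right_mono, rule frac_le)
      show "(real (sum_list (flat ls)))\<^sup>2 \<le> (real N)\<^sup>2"
        using assms(4)[OF ls] by (intro power_mono of_nat_mono) auto
      show "2 ^ p \<le> real (card A) ^ p"
        using assms(2) by (intro power_mono) auto
    qed auto
    finally show "real (card {ps \<in> tuples A {ls}. \<not> repeat_free p (concat (flat ps))}) \<le>
        real N ^ 2 / 2 ^ p * real (card (tuples A {ls}))" .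
  qed
  also have "\<dots> = real N ^ 2 / 2 ^ p * real (card (tuples A Sh))"
    using card_tuples_eq_sum[OF assms(1,3), of "\<lambda>_. True"] by (simp add: sum_distrib_left)
  finally show ?thesis .
qed

lemma proportion_eq_tuples:
  assumes "finite A" "finite Sh"
    and S: "\<And>R. R \<in> S \<Longrightarrow> is_presentation A R \<and> finite R \<and> card R = k"
    and shape: "\<And>ps. set ps \<subseteq> lists A \<times> lists A \<Longrightarrow> distinct ps \<Longrightarrow> shape ps \<in> Sh \<longleftrightarrow> set ps \<in> S"
  shows "proportion P S = real (card {ps \<in> tuples A Sh. distinct ps \<and> P (set ps)}) /
    real (card {ps \<in> tuples A Sh. distinct ps})"
proof -
  have eq: "{ps \<in> tuples A Sh. distinct ps \<and> P (set ps)} = {ps. distinct ps \<and> set ps \<in> {R \<in> S. P R}}" for P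
  proof (rule Collect_cong)
    fix ps
    show "ps \<in> tuples A Sh \<and> distinct ps \<and> P (set ps) \<longleftrightarrow> distinct ps \<and> set ps \<in> {R \<in> S. P R}"
      using shape[of ps] S[of "set ps"] by (auto simp only: tuples_def is_presentation_def mem_Collect_eq)
  qed
  \<comment> \<open>Every member of \<open>S\<close> is listed by some tuple, which makes
    \<open>S\<close> finite, as counting the orderings requires.\<close>
  have "S \<subseteq> set ` tuples A Sh"
  proof
    fix R assume R: "R \<in> S"
    then have "finite R"
      using S by blast
    then obtain ps where ps: "set ps = R" "distinct ps"
      using finite_distinct_list by blast
    then have "ps \<in> tuples A Sh"
      using shape[of ps] R S unfolding tuples_def is_presentation_def by blast
    then show "R \<in> set ` tuples A Sh"
      using ps by blast
  qed
  then have finS: "finite S"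
    using finite_tuples[OF assms(1,2)] finite_subset by blast
  have card: "card {ps \<in> tuples A Sh. distinct ps \<and> P (set ps)} = fact k * card {R \<in> S. P R}" for P
    unfolding eq by (rule card_distinct_lists) (use finS S in auto)
  show ?thesis
    using card[of P] card[of "\<lambda>_. True"] by (simp add: proportion_def)
qed

text \<open>The common core of all six limits. The length \<open>3 * p n + 2\<close> secures both
  the \<open>3 * p\<close> of \<open>small_overlap\<close> and the length 2 required for
  \<open>Q\<close>. Outside the rare tuples with a shorter side or a repeated factor, a tuple has no
  duplicates and \<open>P\<close> reduces to testing \<open>Q\<close> relation by relation, which
  has density \<open>c ^ k\<close>.\<close>

lemma proportion_tendsto:
  fixes A :: "'a set" and c :: real and Sh :: "nat \<Rightarrow> (nat \<times> nat) list set"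
  assumes A: "finite A" "card A \<ge> 2"
    and Sh: "\<And>n. finite (Sh n)" "\<And>n. Sh n \<noteq> {}" "\<And>n ls. ls \<in> Sh n \<Longrightarrow> length ls = k"
      "\<And>n ls. ls \<in> Sh n \<Longrightarrow> sum_list (flat ls) \<le> 2 * k * n"
    and p: "\<forall>\<^sub>F n in sequentially. p n > 0" "(\<lambda>n. real n ^ 2 / 2 ^ p n) \<longlonglongrightarrow> 0"
    and short: "(\<lambda>n. real (card {ps \<in> tuples A (Sh n). is_short (3 * p n + 2) (shape ps)}) /
      real (card (tuples A (Sh n)))) \<longlonglongrightarrow> 0"
    and S: "\<And>n R. R \<in> S n \<Longrightarrow> is_presentation A R \<and> finite R \<and> card R = k"
    and shape: "\<And>n ps. set ps \<subseteq> lists A \<times> lists A \<Longrightarrow> distinct ps \<Longrightarrow>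
      shape ps \<in> Sh n \<longleftrightarrow> set ps \<in> S n"
    and c: "c \<ge> 0"
    and Q: "\<And>l l'. l \<ge> 2 \<Longrightarrow> l' \<ge> 2 \<Longrightarrow>
      real (card {r \<in> words A l \<times> words A l'. Q r}) = c * real (card A) ^ (l + l')"
    and P: "\<And>R q. small_overlap R q \<Longrightarrow> is_presentation A R \<Longrightarrow> P R \<longleftrightarrow> (\<forall>r\<in>R. Q r)"
  shows "(\<lambda>n. proportion P (S n)) \<longlonglongrightarrow> c ^ k"
proof -
  define T where "T n = tuples A (Sh n)" for n
  define Bs where "Bs n = {ps \<in> T n. is_short (3 * p n + 2) (shape ps)}" for n
  define Br where "Br n = {ps \<in> T n. \<not> repeat_free (p n) (concat (flat ps))}" for n
  define D where "D n = {ps \<in> T n. distinct ps}" for n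
  define X where "X n = {ps \<in> T n. distinct ps \<and> P (set ps)}" for n
  define Y where "Y n = {ps \<in> T n. \<forall>r\<in>set ps. Q r}" for n
  define \<epsilon> where "\<epsilon> n = (real (card (Br n)) + real (card (Bs n))) / real (card (T n))" for n
  have fin [simp]: "finite (T n)" for n
    using A(1) Sh(1) by (simp add: T_def finite_tuples)
  have fin' [simp]: "finite (Bs n)" "finite (Br n)" "finite (D n)" "finite (X n)" "finite (Y n)" for n
    by (simp_all add: Bs_def Br_def D_def X_def Y_def)
  have T_pos: "card (T n) > 0" for n
  proof -
    obtain ls where "ls \<in> Sh n"
      using Sh(2) by blast
    then have "tuples A {ls} \<subseteq> T n"
      by (auto simp: T_def tuples_def)
    then have "card A ^ sum_list (flat ls) \<le> card (T n)"
      using card_mono[OF fin] card_tuples_singleton[OF A(1)] by metis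
    moreover have "card A ^ sum_list (flat ls) > 0"
      using A(2) by simp
    ultimately show ?thesis
      by linarith
  qed
  have good: "distinct ps \<and> (P (set ps) \<longleftrightarrow> (\<forall>r\<in>set ps. Q r))"
    if "p n > 0" "ps \<in> T n" "ps \<notin> Bs n \<union> Br n" for n ps
  proof -
    have rf: "repeat_free (p n) (concat (flat ps))"
      using that by (auto simp: Br_def)
    have not_short: "\<not> is_short (3 * p n + 2) (shape ps)"
      using that by (simp add: Bs_def)
    have "3 * p n < length w" if "w \<in> set (flat ps)" for w
    proof -
      have "length w \<in> set (flat (shape ps))"
        using that by (simp add: flat_shape)
      then show ?thesis
        using not_short by (auto simp: is_short_def not_less)
    qed
    then have so: "distinct ps" "small_overlap (set ps) (p n)"
      using small_overlap_if_repeat_free[OF rf \<open>p n > 0\<close>] by auto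
    have "is_presentation A (set ps)"
      using that(2) unfolding T_def tuples_def is_presentation_def by blast
    then show ?thesis
      using so P[OF so(2)] by blast
  qed
  \<comment> \<open>The total length is at most \<open>2 * k * n\<close>, whose square is
    \<open>4 * k ^ 2 * n ^ 2\<close>.\<close>
  have Br_le: "real (card (Br n)) \<le> 4 * real k ^ 2 * (real n ^ 2 / 2 ^ p n) * real (card (T n))" if "p n > 0" for n
    using card_tuples_repeats_le[OF A Sh(1) Sh(4) that]
    by (simp add: Br_def T_def power_mult_distrib)
  have "(\<lambda>n. real (card (Br n)) / real (card (T n))) \<longlonglongrightarrow> 0"
  proof (rule null_comparison)
    show "\<forall>\<^sub>F n in sequentially. norm (real (card (Br n)) / real (card (T n))) \<le> 4 * real k ^ 2 * (real n ^ 2 / 2 ^ p n)"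
      using p(1) by eventually_elim (use Br_le T_pos in \<open>simp add: divide_le_eq\<close>)
    show "(\<lambda>n. 4 * real k ^ 2 * (real n ^ 2 / 2 ^ p n)) \<longlonglongrightarrow> 0"
      by (rule tendsto_mult_right_zero[OF p(2)])
  qed
  then have \<epsilon>: "\<epsilon> \<longlonglongrightarrow> 0"
    using tendsto_add[OF _ short] by (simp add: \<epsilon>_def [abs_def] add_divide_distrib Bs_def T_def)
  have sub: "X n \<subseteq> Y n \<union> (Br n \<union> Bs n)" "Y n \<subseteq> X n \<union> (Br n \<union> Bs n)" "T n \<subseteq> D n \<union> (Br n \<union> Bs n)"
    if "p n > 0" for n
    using good[OF that] by (auto simp: X_def Y_def D_def)
  have B_le: "real (card (Br n \<union> Bs n)) \<le> real (card (Br n)) + real (card (Bs n))" for n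
    by (metis card_Un_le of_nat_add of_nat_le_iff)
  \<comment> \<open>Passing from \<open>X\<close> to \<open>Y\<close> costs \<open>Br\<close> and
    \<open>Bs\<close> once; estimating \<open>Y\<close> costs \<open>Bs\<close> another
    \<open>1 + c ^ k\<close> times. Hence the constant \<open>2 + c ^ k\<close>.\<close>
  have X_le: "\<bar>real (card (X n)) - c ^ k * real (card (T n))\<bar> \<le>
      (2 + c ^ k) * (real (card (Br n)) + real (card (Bs n)))" if "p n > 0" for n
  proof -
    have "\<bar>real (card (X n)) - real (card (Y n))\<bar> \<le> real (card (Br n)) + real (card (Bs n))"
      using card_le_card_plus_if_subset_Un[OF _ sub(1)[OF that]] card_le_card_plus_if_subset_Un[OF _ sub(2)[OF that]] B_le[of n] by fastforce
    moreover have "\<bar>real (card (Y n)) - c ^ k * real (card (T n))\<bar> \<le> (1 + c ^ k) * real (card (Bs n))"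
      unfolding Y_def T_def Bs_def by (rule card_tuples_filter_estimate) (use A Sh Q c in auto)
    moreover have "(1 + c ^ k) * real (card (Br n)) \<ge> 0"
      using c by simp
    ultimately show ?thesis
      by (simp add: algebra_simps)
  qed
  have X_est: "\<bar>real (card (X n)) / real (card (T n)) - c ^ k\<bar> \<le> (2 + c ^ k) * \<epsilon> n" if "p n > 0" for n
  proof -
    have "real (card (X n)) / real (card (T n)) - c ^ k =
        (real (card (X n)) - c ^ k * real (card (T n))) / real (card (T n))"
      using T_pos[of n] by (auto simp: diff_divide_distrib)
    then show ?thesis
      using divide_right_mono[OF X_le[OF that], of "real (card (T n))"] by (simp add: \<epsilon>_def)
  qed
  have X_lim: "(\<lambda>n. real (card (X n)) / real (card (T n))) \<longlonglongrightarrow> c ^ k"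
  proof (rule LIM_zero_cancel, rule null_comparison)
    show "\<forall>\<^sub>F n in sequentially.
        norm (real (card (X n)) / real (card (T n)) - c ^ k) \<le> (2 + c ^ k) * \<epsilon> n"
      using p(1) by eventually_elim (use X_est in simp)
  qed (rule tendsto_mult_right_zero[OF \<epsilon>])
  \<comment> \<open>Almost all tuples are free of duplicates, so counting relative to
    \<open>T\<close> changes the proportion only by a factor tending to 1.\<close>
  have D_lim: "(\<lambda>n. real (card (D n)) / real (card (T n))) \<longlonglongrightarrow> 1"
  proof (rule tendsto_sandwich)
    show "\<forall>\<^sub>F n in sequentially. 1 - \<epsilon> n \<le> real (card (D n)) / real (card (T n))"
      using p(1)
    proof eventually_elim
      case (elim n)
      have "real (card (T n)) \<le> real (card (D n)) + (real (card (Br n)) + real (card (Bs n)))"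
        using card_le_card_plus_if_subset_Un[OF _ sub(3)[OF elim]] B_le[of n] by fastforce
      then have "(real (card (T n)) - (real (card (Br n)) + real (card (Bs n)))) / real (card (T n)) \<le>
          real (card (D n)) / real (card (T n))"
        by (intro divide_right_mono) auto
      then show ?case
        using T_pos[of n] by (auto simp: \<epsilon>_def diff_divide_distrib split: if_splits)
    qed
    have "card (D n) \<le> card (T n)" for n
      by (rule card_mono) (auto simp: D_def)
    then show "\<forall>\<^sub>F n in sequentially. real (card (D n)) / real (card (T n)) \<le> 1"
      using T_pos by (simp add: divide_le_eq)
    show "(\<lambda>n. 1 - \<epsilon> n) \<longlonglongrightarrow> 1"
      using tendsto_diff[OF tendsto_const \<epsilon>, of 1] by simp
  qed simp
  have "proportion P (S n) = (real (card (X n)) / real (card (T n))) / (real (card (D n)) / real (card (T n)))" for n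
    using proportion_eq_tuples[OF A(1) Sh(1) S shape] T_pos[of n] by (simp add: X_def D_def T_def)
  then show ?thesis
    using tendsto_divide[OF X_lim D_lim] by simp
qed

section \<open>Pairs of words with different end letters\<close>

lemma card_neq_pairs:
  assumes "finite A"
  shows "real (card {(a, b) \<in> A \<times> A. a \<noteq> b}) = real (card A) * (real (card A) - 1)"
proof -
  have "{(a, b) \<in> A \<times> A. a \<noteq> b} = A \<times> A - (\<lambda>a. (a, a)) ` A"
    by auto
  moreover have "card ((\<lambda>a. (a, a)) ` A) = card A"
    by (simp add: card_image inj_on_def)
  ultimately have "card {(a, b) \<in> A \<times> A. a \<noteq> b} = card A * card A - card A"
    using assms by (simp add: card_Diff_subset card_cartesian_product image_subset_iff)
  then show ?thesis
    by (cases "card A") (simp_all add: algebra_simps)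
qed

lemma card_heads_differ:
  assumes "finite A" "card A > 0" "l \<ge> 1" "l' \<ge> 1"
  shows "real (card {r \<in> words A l \<times> words A l'. case r of (u, v) \<Rightarrow> hd u \<noteq> hd v}) =
    (real (card A) - 1) / real (card A) * real (card A) ^ (l + l')"
proof -
  obtain m m' where l: "l = Suc m" "l' = Suc m'"
    using assms(3,4) by (metis Suc_le_D One_nat_def)
  have "bij_betw (\<lambda>((a, b), u, v). (a # u, b # v))
      ({(a, b) \<in> A \<times> A. a \<noteq> b} \<times> words A m \<times> words A m')
      {r \<in> words A l \<times> words A l'. case r of (u, v) \<Rightarrow> hd u \<noteq> hd v}"
    by (rule bij_betw_byWitness[where f' = "\<lambda>(u, v). ((hd u, hd v), tl u, tl v)"])
      (auto simp: words_def l length_Suc_conv)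
  from bij_betw_same_card[OF this, symmetric] show ?thesis
    using assms card_neq_pairs[OF assms(1)]
    by (simp add: card_cartesian_product card_words l power_add)
qed

lemma card_lasts_differ:
  assumes "finite A" "card A > 0" "l \<ge> 1" "l' \<ge> 1"
  shows "real (card {r \<in> words A l \<times> words A l'. case r of (u, v) \<Rightarrow> last u \<noteq> last v}) =
    (real (card A) - 1) / real (card A) * real (card A) ^ (l + l')"
proof -
  have "bij_betw (map_prod rev rev)
      {r \<in> words A l \<times> words A l'. case r of (u, v) \<Rightarrow> hd u \<noteq> hd v}
      {r \<in> words A l \<times> words A l'. case r of (u, v) \<Rightarrow> last u \<noteq> last v}"
    by (rule bij_betw_byWitness[where f' = "map_prod rev rev"])
      (auto simp: words_def last_rev hd_rev)
  from bij_betw_same_card[OF this] show ?thesis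
    using card_heads_differ[OF assms] by simp
qed

lemma words_Suc_Suc:
  "w \<in> words A (Suc (Suc m)) \<longleftrightarrow> (\<exists>a\<in>A. \<exists>c\<in>A. \<exists>u\<in>words A m. w = a # u @ [c])"
proof
  assume w: "w \<in> words A (Suc (Suc m))"
  then obtain a w' where "w = a # w'" "length w' = Suc m"
    by (auto simp: words_def length_Suc_conv)
  moreover from this obtain u c where "w' = u @ [c]"
    by (cases w' rule: rev_exhaust) auto
  ultimately have "w = a # u @ [c]" "a \<in> A" "c \<in> A" "u \<in> words A m"
    using w by (auto simp: words_def)
  then show "\<exists>a\<in>A. \<exists>c\<in>A. \<exists>u\<in>words A m. w = a # u @ [c]"
    by blast
qed (auto simp: words_def)

text \<open>Length at least 2 puts the first and the last letter at different positions, so the two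
  conditions are independent and their densities multiply.\<close>

lemma card_heads_lasts_differ:
  assumes "finite A" "card A > 0" "l \<ge> 2" "l' \<ge> 2"
  shows "real (card {r \<in> words A l \<times> words A l'. case r of (u, v) \<Rightarrow> hd u \<noteq> hd v \<and> last u \<noteq> last v}) =
    ((real (card A) - 1) / real (card A)) ^ 2 * real (card A) ^ (l + l')"
proof -
  obtain m m' where l: "l = Suc (Suc m)" "l' = Suc (Suc m')"
    using assms(3,4) by (metis Suc_le_D numeral_2_eq_2 Suc_le_mono)
  have "bij_betw (\<lambda>((a, b), (c, d), u, v). (a # u @ [c], b # v @ [d]))
      ({(a, b) \<in> A \<times> A. a \<noteq> b} \<times> {(a, b) \<in> A \<times> A. a \<noteq> b} \<times> words A m \<times> words A m')
      {r \<in> words A l \<times> words A l'. case r of (u, v) \<Rightarrow> hd u \<noteq> hd v \<and> last u \<noteq> last v}"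
    (is "bij_betw ?f ?X ?Y")
  proof (rule bij_betw_imageI)
    show "inj_on ?f ?X"
      by (auto simp: inj_on_def)
    have "r \<in> ?f ` ?X" if r: "r \<in> ?Y" for r
    proof -
      from r obtain a c u b d v where "a \<in> A" "c \<in> A" "u \<in> words A m" "b \<in> A" "d \<in> A" "v \<in> words A m'"
          "r = (a # u @ [c], b # v @ [d])"
        by (auto simp: l words_Suc_Suc)
      with r show ?thesis
        by (intro image_eqI[of _ _ "((a, b), (c, d), u, v)"]) auto
    qed
    moreover have "?f ` ?X \<subseteq> ?Y"
      by (auto simp: l words_Suc_Suc)
    ultimately show "?f ` ?X = ?Y"
      by blast
  qed
  from bij_betw_same_card[OF this, symmetric] show ?thesis
    using assms card_neq_pairs[OF assms(1)]
    by (simp add: card_cartesian_product card_words l power_add power2_eq_square)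
qed

section \<open>Lists of given sum with a small entry\<close>

text \<open>Stars and bars: removing a small entry, with \<open>m\<close> choices for its position
  and \<open>L\<close> for its value, leaves one of at most
  \<open>(n + m - 2) choose (m - 2)\<close> lists, against \<open>(n + m - 1) choose (m - 1)\<close>
  lists in all. Cross-multiplying keeps the comparison in the naturals.\<close>

lemma card_short_sum_lists:
  assumes "m \<ge> 2"
  shows "card {xs :: nat list. length xs = m \<and> sum_list xs = n \<and> (\<exists>l\<in>set xs. l < L)} * (n + m - 1)
    \<le> m * L * (m - 1) * card {xs :: nat list. length xs = m \<and> sum_list xs = n}"
proof -
  obtain m' where m: "m = Suc (Suc m')"
    using assms by (metis Suc_le_D numeral_2_eq_2 Suc_le_mono)
  let ?X = "{xs :: nat list. length xs = m \<and> sum_list xs = n \<and> (\<exists>l\<in>set xs. l < L)}"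
  \<comment> \<open>Writing \<open>sum_list xs + j = n\<close> avoids truncated subtraction: the set
    is empty for \<open>j > n\<close>.\<close>
  let ?Z = "\<lambda>j. {xs :: nat list. length xs = Suc m' \<and> sum_list xs + j = n}"
  let ?U = "\<Union>(i, j)\<in>{..<m} \<times> {..<L}. (\<lambda>xs. take i xs @ j # drop i xs) ` ?Z j"
  have Z: "finite (?Z j) \<and> card (?Z j) \<le> (n + m') choose m'" for j
  proof (cases "j \<le> n")
    case True
    then have "?Z j = {xs. length xs = Suc m' \<and> sum_list xs = n - j}"
      by auto
    then have card: "card (?Z j) = (n - j + m') choose m'"
      using card_length_sum_list[of "Suc m'" "n - j"] binomial_symmetric[of "n - j" "n - j + m'"] by simp
    \<comment> \<open>An infinite set would have cardinality 0, so a positive count also proves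
      finiteness.\<close>
    then have "card (?Z j) > 0"
      by simp
    then have "finite (?Z j)"
      using card_ge_0_finite by blast
    then show ?thesis
      unfolding card using binomial_right_mono[of "n - j + m'" "n + m'" m'] by simp
  next
    case False
    then have "?Z j = {}"
      by auto
    then show ?thesis
      by (simp only: finite.emptyI card.empty) simp
  qed
  have "?X \<subseteq> ?U"
  proof
    fix xs assume xs: "xs \<in> ?X"
    then obtain j ys zs where j: "j < L" "xs = ys @ j # zs"
      by (auto dest!: split_list)
    have "ys @ zs \<in> ?Z j" "length ys < m" "xs = take (length ys) (ys @ zs) @ j # drop (length ys) (ys @ zs)"
      using xs j m by auto
    then show "xs \<in> ?U"
      using j(1) by blast
  qed
  moreover have "finite ?U"
    using Z by auto
  ultimately have "card ?X \<le> card ?U"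
    by (rule card_mono[rotated])
  also have "\<dots> \<le> (\<Sum>(i, j)\<in>{..<m} \<times> {..<L}. card ((\<lambda>xs. take i xs @ j # drop i xs) ` ?Z j))"
    using card_UN_le[of "{..<m} \<times> {..<L}" "\<lambda>(i, j). (\<lambda>xs. take i xs @ j # drop i xs) ` ?Z j"]
    by (simp add: case_prod_unfold)
  also have "\<dots> \<le> (\<Sum>(i, j)\<in>{..<m} \<times> {..<L}. (n + m') choose m')"
    using Z card_image_le by (intro sum_mono) (fastforce intro: order_trans)
  also have "\<dots> = m * L * ((n + m') choose m')"
    by simp
  finally have "card ?X * Suc (n + m') \<le> m * L * ((n + m') choose m') * Suc (n + m')"
    by (rule mult_le_mono1)
  also have "\<dots> = m * L * (((n + m') choose m') * Suc (n + m'))"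
    by (rule mult.assoc)
  \<comment> \<open>The absorption identity trades the factor \<open>n + m - 1\<close> for
    \<open>m - 1\<close> and turns the binomial into the total number of lists.\<close>
  also have "((n + m') choose m') * Suc (n + m') = Suc m' * (Suc (n + m') choose Suc m')"
    using Suc_times_binomial[of m' "n + m'"] by (simp add: mult.commute)
  also have "Suc (n + m') choose Suc m' = card {xs :: nat list. length xs = m \<and> sum_list xs = n}"
    using card_length_sum_list[of m n] binomial_symmetric[of n "Suc (n + m')"] by (simp add: m)
  finally show ?thesis
    by (simp add: m mult.assoc del: mult_Suc mult_Suc_right)
qed

lemma card_tuples:
  assumes "finite A" "finite Sh"
  shows "card (tuples A Sh) = (\<Sum>ls\<in>Sh. card A ^ sum_list (flat ls))"
  using card_tuples_eq_sum[OF assms, of "\<lambda>_. True"] card_tuples_singleton[OF assms(1)] by simp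

section \<open>Choice of the overlap threshold\<close>

text \<open>The threshold has to lie well above \<open>log n\<close> and well below
  \<open>n\<close>: \<open>2 ^ p\<close> must outgrow \<open>n ^ 2\<close> while
  \<open>3 * p + 2\<close> stays negligible against \<open>n\<close>. The square root does
  both.\<close>

definition sqrt_floor :: "nat \<Rightarrow> nat" where
  "sqrt_floor n = nat \<lfloor>sqrt (real n)\<rfloor>"

lemma sqrt_floor_bounds: "real (sqrt_floor n) \<le> sqrt (real n)" "sqrt (real n) - 1 \<le> real (sqrt_floor n)"
  unfolding sqrt_floor_def by simp_all

lemma sqrt_floor_pos: "\<forall>\<^sub>F n in sequentially. sqrt_floor n > 0"
  using eventually_gt_at_top[of 0] by eventually_elim (simp add: sqrt_floor_def)

lemma square_over_exp_sqrt_floor: "(\<lambda>n. real n ^ 2 / 2 ^ sqrt_floor n) \<longlonglongrightarrow> 0"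
proof (rule null_comparison)
  show "\<forall>\<^sub>F n in sequentially. norm (real n ^ 2 / 2 ^ sqrt_floor n) \<le> real n ^ 2 / 2 powr (sqrt (real n) - 1)"
  proof (rule always_eventually, rule allI)
    fix n
    have "2 powr (sqrt (real n) - 1) \<le> 2 powr real (sqrt_floor n)"
      using sqrt_floor_bounds(2) by (intro powr_mono) auto
    then have "2 powr (sqrt (real n) - 1) \<le> (2 :: real) ^ sqrt_floor n"
      by (simp add: powr_realpow)
    then show "norm (real n ^ 2 / 2 ^ sqrt_floor n) \<le> real n ^ 2 / 2 powr (sqrt (real n) - 1)"
      by (simp add: frac_le)
  qed
  show "(\<lambda>n. real n ^ 2 / 2 powr (sqrt (real n) - 1)) \<longlonglongrightarrow> 0"
    by real_asymp
qed

section \<open>Shapes of given sum relation length\<close>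

definition shapes_sum :: "nat \<Rightarrow> nat \<Rightarrow> (nat \<times> nat) list set" where
  "shapes_sum k n = {ls. length ls = k \<and> sum_list (flat ls) = n}"

lemma card_shapes_sum:
  "card {ls \<in> shapes_sum k n. \<Phi> (flat ls)} = card {xs. length xs = 2 * k \<and> sum_list xs = n \<and> \<Phi> xs}"
  using bij_betw_same_card[OF bij_betw_flat[of k "\<lambda>xs. sum_list xs = n \<and> \<Phi> xs"]]
  by (simp add: shapes_sum_def)

lemma shapes_sum_nonempty:
  assumes "k > 0"
  shows "shapes_sum k n \<noteq> {}"
proof -
  have "sum_list (flat (replicate j (0, 0))) = (0 :: nat)" for j
    by (induction j) auto
  then have "(n, 0) # replicate (k - 1) (0, 0) \<in> shapes_sum k n"
    using assms by (simp add: shapes_sum_def)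
  then show ?thesis
    by blast
qed

lemma finite_shapes_sum:
  assumes "k > 0"
  shows "finite (shapes_sum k n)"
proof -
  have "card (shapes_sum k n) = (n + 2 * k - 1) choose n"
    using card_shapes_sum[of k n "\<lambda>_. True"] card_length_sum_list[of "2 * k" n] by simp
  moreover have "n \<le> n + 2 * k - 1"
    using assms by simp
  ultimately have "card (shapes_sum k n) > 0"
    by simp
  then show ?thesis
    by (rule card_ge_0_finite)
qed

text \<open>All shapes with sum \<open>n\<close> carry the same number \<open>card A ^ n\<close> of
  tuples, so the proportion is one of shapes. \<open>card_short_sum_lists\<close> with
  \<open>m = 2 * k\<close> bounds it by a constant times \<open>L / n\<close>, where
  \<open>L\<close> is of order \<open>sqrt n\<close>.\<close>

lemma short_shapes_sum_negligible:
  assumes "finite A" "card A \<ge> 2" "k > 0"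
  shows "(\<lambda>n. real (card {ps \<in> tuples A (shapes_sum k n). is_short (3 * sqrt_floor n + 2) (shape ps)}) /
    real (card (tuples A (shapes_sum k n)))) \<longlonglongrightarrow> 0"
proof (rule null_comparison)
  show "(\<lambda>n. 4 * real k ^ 2 * ((3 * sqrt (real n) + 2) / real n)) \<longlonglongrightarrow> 0"
    by (rule tendsto_mult_right_zero) real_asymp
  show "\<forall>\<^sub>F n in sequentially. norm (real (card {ps \<in> tuples A (shapes_sum k n).
      is_short (3 * sqrt_floor n + 2) (shape ps)}) / real (card (tuples A (shapes_sum k n))))
      \<le> 4 * real k ^ 2 * ((3 * sqrt (real n) + 2) / real n)"
    using eventually_gt_at_top[of 0]
  proof eventually_elim
    case (elim n)
    define L where "L = 3 * sqrt_floor n + 2"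
    define N where "N = card (shapes_sum k n)"
    define Ns where "Ns = card {ls \<in> shapes_sum k n. is_short L ls}"
    note fin = finite_shapes_sum[OF assms(3), of n]
    have "card (tuples A (shapes_sum k n)) = N * card A ^ n"
      using card_tuples[OF assms(1) fin] by (simp add: N_def shapes_sum_def)
    moreover have "card {ps \<in> tuples A (shapes_sum k n). is_short L (shape ps)} = Ns * card A ^ n"
      unfolding tuples_restrict[symmetric]
      by (subst card_tuples[OF assms(1)]) (use fin in \<open>simp, simp add: Ns_def shapes_sum_def\<close>)
    moreover have "N > 0"
      using fin shapes_sum_nonempty[OF assms(3)] by (simp add: N_def card_gt_0_iff)
    ultimately have ratio: "norm (real (card {ps \<in> tuples A (shapes_sum k n). is_short L (shape ps)}) /
        real (card (tuples A (shapes_sum k n)))) = real Ns / real N"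
      using assms(2) by auto
    have "Ns * n \<le> Ns * (n + 2 * k - 1)"
      using assms(3) by (intro mult_le_mono2) simp
    also have "\<dots> \<le> 2 * k * L * (2 * k - 1) * N"
      using card_short_sum_lists[of "2 * k" n L] assms(3)
        card_shapes_sum[of k n "\<lambda>_. True"] card_shapes_sum[of k n "\<lambda>xs. \<exists>l\<in>set xs. l < L"]
      by (simp add: N_def Ns_def is_short_def)
    also have "\<dots> \<le> 2 * k * L * (2 * k) * N"
      by (intro mult_le_mono1 mult_le_mono2) simp
    also have "\<dots> = 4 * k ^ 2 * L * N"
      by (simp add: power2_eq_square)
    finally have "Ns * n \<le> 4 * k ^ 2 * L * N" .
    from of_nat_mono[OF this, where 'a = real]
    have "real Ns * real n \<le> 4 * real k ^ 2 * real L * real N"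
      by simp
    then have "real Ns / real N \<le> 4 * real k ^ 2 * (real L / real n)"
      using \<open>N > 0\<close> elim by (simp add: field_simps)
    also have "\<dots> \<le> 4 * real k ^ 2 * ((3 * sqrt (real n) + 2) / real n)"
      using sqrt_floor_bounds(1)[of n] by (intro mult_left_mono divide_right_mono) (auto simp: L_def)
    finally show ?case
      unfolding ratio[unfolded L_def] .
  qed
qed

section \<open>Shapes of given maximum relation length\<close>

definition shapes_max :: "nat \<Rightarrow> nat \<Rightarrow> (nat \<times> nat) list set" where
  "shapes_max k n = {ls. length ls = k \<and> Max (insert 0 (set (flat ls))) = n}"

lemma shapes_max_le:
  assumes "ls \<in> shapes_max k n" "l \<in> set (flat ls)"
  shows "l \<le> n"
  using assms Max_ge[of "insert 0 (set (flat ls))" l] by (simp add: shapes_max_def)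

lemma shapes_max_bounded:
  "finite {ls. length ls = k \<and> set (flat ls) \<subseteq> {..n}}"
  "card {ls. length ls = k \<and> set (flat ls) \<subseteq> {..n}} = Suc n ^ (2 * k)"
proof -
  have bij: "bij_betw flat {ls. length ls = k \<and> set (flat ls) \<subseteq> {..n}} {xs. set xs \<subseteq> {..n} \<and> length xs = 2 * k}"
    using bij_betw_flat[of k "\<lambda>xs. set xs \<subseteq> {..n}"] by (simp add: conj_commute)
  show "finite {ls. length ls = k \<and> set (flat ls) \<subseteq> {..n}}"
    using bij_betw_finite[OF bij] finite_lists_length_eq[of "{..n}"] by simp
  show "card {ls. length ls = k \<and> set (flat ls) \<subseteq> {..n}} = Suc n ^ (2 * k)"
    using bij_betw_same_card[OF bij] card_lists_length_eq[of "{..n}"] by simp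
qed

lemma shapes_max_subset: "shapes_max k n \<subseteq> {ls. length ls = k \<and> set (flat ls) \<subseteq> {..n}}"
proof
  fix ls assume ls: "ls \<in> shapes_max k n"
  then have "length ls = k"
    by (simp add: shapes_max_def)
  moreover have "set (flat ls) \<subseteq> {..n}"
    using shapes_max_le[OF ls] by blast
  ultimately show "ls \<in> {ls. length ls = k \<and> set (flat ls) \<subseteq> {..n}}"
    by simp
qed

lemma finite_shapes_max: "finite (shapes_max k n)"
  by (rule finite_subset[OF shapes_max_subset shapes_max_bounded(1)])

lemma sum_list_le_length_times:
  fixes xs :: "nat list"
  shows "(\<And>x. x \<in> set xs \<Longrightarrow> x \<le> n) \<Longrightarrow> sum_list xs \<le> length xs * n"
proof (induction xs)
  case (Cons x xs)
  then have "x \<le> n" "sum_list xs \<le> length xs * n"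
    by simp_all
  then show ?case
    by simp
qed simp

lemma replicate_in_shapes_max:
  assumes "k > 0"
  shows "replicate k (n, n) \<in> shapes_max k n"
proof -
  have "set (flat (replicate k (n, n))) = {n}"
    using assms by (auto simp: set_flat Field_def)
  then show ?thesis
    by (simp add: shapes_max_def)
qed

text \<open>Shapes now carry different numbers of tuples, and the long ones dominate. A side shorter
  than \<open>L\<close> lowers the exponent from \<open>2 * k * n\<close> to at most
  \<open>(2 * k - 1) * n + L\<close>, and there are at most \<open>(n + 1) ^ (2 * k)\<close> shapes,
  so the exponential loss beats the polynomial factor.\<close>

lemma short_shapes_max_negligible:
  assumes "finite A" "card A \<ge> 2" "k > 0"
  shows "(\<lambda>n. real (card {ps \<in> tuples A (shapes_max k n). is_short (3 * sqrt_floor n + 2) (shape ps)}) /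
    real (card (tuples A (shapes_max k n)))) \<longlonglongrightarrow> 0"
proof (rule null_comparison)
  show "(\<lambda>n. (real n + 1) ^ (2 * k) * 2 powr (3 * sqrt (real n) + 2 - real n)) \<longlonglongrightarrow> 0"
    by real_asymp
  have "\<forall>\<^sub>F n in sequentially. 3 * sqrt (real n) + 2 \<le> real n"
    by real_asymp
  then show "\<forall>\<^sub>F n in sequentially. norm (real (card {ps \<in> tuples A (shapes_max k n).
      is_short (3 * sqrt_floor n + 2) (shape ps)}) / real (card (tuples A (shapes_max k n))))
      \<le> (real n + 1) ^ (2 * k) * 2 powr (3 * sqrt (real n) + 2 - real n)"
  proof eventually_elim
    case (elim n)
    define L where "L = 3 * sqrt_floor n + 2"
    have L_le: "real L \<le> 3 * sqrt (real n) + 2"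
      using sqrt_floor_bounds(1)[of n] by (simp add: L_def)
    with elim have "L \<le> n"
      by linarith
    let ?a = "real (card A)"
    let ?M = "(2 * k - 1) * n"
    let ?short = "{ls \<in> shapes_max k n. is_short L ls}"
    have "sum_list (flat ls) \<le> ?M + L" if ls: "ls \<in> ?short" for ls
    proof -
      obtain l ys zs where l: "l < L" "flat ls = ys @ l # zs"
        using ls by (auto simp: is_short_def dest!: split_list)
      have "length (ys @ zs) = 2 * k - 1"
        using ls l(2) length_flat[of ls] by (simp add: shapes_max_def)
      moreover have "sum_list (ys @ zs) \<le> length (ys @ zs) * n"
        by (rule sum_list_le_length_times) (use ls l(2) shapes_max_le[of ls k n] in auto)
      ultimately show ?thesis
        using l by simp
    qed
    then have "card (tuples A ?short) \<le> card ?short * card A ^ (?M + L)"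
      using card_tuples[OF assms(1), of ?short] finite_shapes_max[of k n] assms(2)
        sum_bounded_above[of ?short "\<lambda>ls. card A ^ sum_list (flat ls)" "card A ^ (?M + L)"]
      by (simp add: power_increasing)
    also have "\<dots> \<le> Suc n ^ (2 * k) * card A ^ (?M + L)"
      using card_mono[OF shapes_max_bounded(1), of ?short k n] shapes_max_bounded(2)[of k n]
        shapes_max_subset[of k n]
      by (intro mult_right_mono) auto
    finally have "real (card (tuples A ?short)) \<le> real (Suc n ^ (2 * k) * card A ^ (?M + L))"
      by (rule of_nat_mono)
    also have "\<dots> = (real n + 1) ^ (2 * k) * ?a ^ (?M + L)"
      by (simp add: add.commute)
    finally have "real (card (tuples A ?short)) \<le> (real n + 1) ^ (2 * k) * ?a ^ (?M + L)" .
    \<comment> \<open>The one shape with all lengths equal to \<open>n\<close> already supplies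
      \<open>card A ^ (2 * k * n)\<close> tuples.\<close>
    moreover have "?a ^ (?M + n) \<le> real (card (tuples A (shapes_max k n)))"
    proof -
      have "sum_list (flat (replicate j (n, n))) = 2 * j * n" for j
        by (induction j) auto
      moreover have "2 * k * n = ?M + n"
        using assms(3) by (cases k) auto
      moreover have "tuples A {replicate k (n, n)} \<subseteq> tuples A (shapes_max k n)"
        using replicate_in_shapes_max[OF assms(3)] by (auto simp: tuples_def)
      ultimately have "card A ^ (?M + n) \<le> card (tuples A (shapes_max k n))"
        using card_mono[OF finite_tuples[OF assms(1) finite_shapes_max]] card_tuples_singleton[OF assms(1)]
        by metis
      then show ?thesis
        using of_nat_mono by fastforce
    qed
    ultimately have "real (card (tuples A ?short)) / real (card (tuples A (shapes_max k n))) \<le>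
        (real n + 1) ^ (2 * k) * ?a ^ (?M + L) / ?a ^ (?M + n)"
      using assms(2) by (intro frac_le) auto
    also have "\<dots> = (real n + 1) ^ (2 * k) * (1 / ?a ^ (n - L))"
    proof -
      have "?a ^ n = ?a ^ L * ?a ^ (n - L)"
        using \<open>L \<le> n\<close> by (simp flip: power_add)
      then show ?thesis
        using assms(2) by (simp add: power_add)
    qed
    also have "\<dots> \<le> (real n + 1) ^ (2 * k) * (1 / 2 ^ (n - L))"
      using assms(2) by (intro mult_left_mono frac_le power_mono) auto
    also have "1 / 2 ^ (n - L) = 2 powr (real L - real n)"
      using \<open>L \<le> n\<close> by (simp add: powr_diff powr_realpow power_diff)
    also have "(real n + 1) ^ (2 * k) * 2 powr (real L - real n) \<le>
        (real n + 1) ^ (2 * k) * 2 powr (3 * sqrt (real n) + 2 - real n)"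
      using L_le by (intro mult_left_mono powr_mono) auto
    finally show ?case
      by (simp add: L_def tuples_restrict)
  qed
qed

section \<open>Relation lengths read off from shapes\<close>

text \<open>Distinctness matters, since the sum over the set counts a repeated relation only
  once.\<close>

lemma sum_rel_length_set:
  assumes "distinct ps"
  shows "sum_rel_length (set ps) = sum_list (flat (shape ps))"
proof -
  have "sum_list (map (\<lambda>(u, v). length u + length v) ps) = sum_list (flat (shape ps))"
    by (induction ps rule: flat.induct) (auto simp: shape_def)
  then show ?thesis
    using assms by (simp add: sum_rel_length_def sum.distinct_set_conv_list)
qed

lemma max_rel_length_set: "max_rel_length (set ps) = Max (insert 0 (set (flat (shape ps))))"
proof -
  \<comment> \<open>Two numbers with the same upper bounds are equal, which sidesteps the nested
    maxima.\<close>
  have "max_rel_length (set ps) \<le> m \<longleftrightarrow> Max (insert 0 (set (flat (shape ps)))) \<le> m" for m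
  proof -
    have "max_rel_length (set ps) \<le> m \<longleftrightarrow> (\<forall>(u, v)\<in>set ps. length u \<le> m \<and> length v \<le> m)"
      by (auto simp: max_rel_length_def)
    also have "\<dots> \<longleftrightarrow> Max (insert 0 (set (flat (shape ps)))) \<le> m"
      unfolding flat_shape set_map set_flat Field_def by (subst Max_le_iff) (auto simp: finite_Domain finite_Range)
    finally show ?thesis .
  qed
  then show ?thesis
    by (metis order_antisym order_refl)
qed

section \<open>Limits for the two length measures\<close>

lemma proportion_pres_sum_tendsto:
  fixes A :: "'a set" and c :: real
  assumes "finite A" "card A \<ge> 2" "k > 0" "c \<ge> 0"
    and "\<And>l l'. l \<ge> 2 \<Longrightarrow> l' \<ge> 2 \<Longrightarrow>
      real (card {r \<in> words A l \<times> words A l'. Q r}) = c * real (card A) ^ (l + l')"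
    and "\<And>R q. small_overlap R q \<Longrightarrow> is_presentation A R \<Longrightarrow> P R \<longleftrightarrow> (\<forall>r\<in>R. Q r)"
  shows "(\<lambda>n. proportion P (pres_sum A k n)) \<longlonglongrightarrow> c ^ k"
proof (rule proportion_tendsto[where Sh = "shapes_sum k" and p = sqrt_floor and A = A and Q = Q])
  show "sum_list (flat ls) \<le> 2 * k * n" if "ls \<in> shapes_sum k n" for ls n
    using that assms(3) by (cases k) (auto simp: shapes_sum_def)
  show "shape ps \<in> shapes_sum k n \<longleftrightarrow> set ps \<in> pres_sum A k n"
    if "set ps \<subseteq> lists A \<times> lists A" "distinct ps" for n ps
    using that by (auto simp only: shapes_sum_def pres_sum_def is_presentation_def mem_Collect_eq
      sum_rel_length_set distinct_card length_shape finite_set)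
  show "length ls = k" if "ls \<in> shapes_sum k n" for ls n
    using that by (simp add: shapes_sum_def)
  show "is_presentation A R \<and> finite R \<and> card R = k" if "R \<in> pres_sum A k n" for R n
    using that by (simp add: pres_sum_def)
qed (fact finite_shapes_sum[OF assms(3)] shapes_sum_nonempty[OF assms(3)] sqrt_floor_pos
    square_over_exp_sqrt_floor short_shapes_sum_negligible[OF assms(1-3)] assms)+

lemma proportion_pres_max_tendsto:
  fixes A :: "'a set" and c :: real
  assumes "finite A" "card A \<ge> 2" "k > 0" "c \<ge> 0"
    and "\<And>l l'. l \<ge> 2 \<Longrightarrow> l' \<ge> 2 \<Longrightarrow>
      real (card {r \<in> words A l \<times> words A l'. Q r}) = c * real (card A) ^ (l + l')"
    and "\<And>R q. small_overlap R q \<Longrightarrow> is_presentation A R \<Longrightarrow> P R \<longleftrightarrow> (\<forall>r\<in>R. Q r)"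
  shows "(\<lambda>n. proportion P (pres_max A k n)) \<longlonglongrightarrow> c ^ k"
proof (rule proportion_tendsto[where Sh = "shapes_max k" and p = sqrt_floor and A = A and Q = Q])
  show "sum_list (flat ls) \<le> 2 * k * n" if "ls \<in> shapes_max k n" for ls n
    using sum_list_le_length_times[of "flat ls" n] shapes_max_le[OF that] that
    by (simp add: length_flat shapes_max_def)
  show "shape ps \<in> shapes_max k n \<longleftrightarrow> set ps \<in> pres_max A k n"
    if "set ps \<subseteq> lists A \<times> lists A" "distinct ps" for n ps
    using that by (auto simp only: shapes_max_def pres_max_def is_presentation_def mem_Collect_eq
      max_rel_length_set distinct_card length_shape finite_set)
  show "shapes_max k n \<noteq> {}" for n
    using replicate_in_shapes_max[OF assms(3)] by blast
  show "length ls = k" if "ls \<in> shapes_max k n" for ls n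
    using that by (simp add: shapes_max_def)
  show "is_presentation A R \<and> finite R \<and> card R = k" if "R \<in> pres_max A k n" for R n
    using that by (simp add: pres_max_def)
qed (fact finite_shapes_max sqrt_floor_pos square_over_exp_sqrt_floor
    short_shapes_max_negligible[OF assms(1-3)] assms)+

theorem theorem6:
  fixes A :: "'a set" and k :: nat
  assumes "finite A" and "card A \<ge> 2" and "k > 0"
  shows "((\<lambda>n. proportion (left_cancellative_pres A) (pres_sum A k n))
           \<longlonglongrightarrow> ((real (card A) - 1) / real (card A)) ^ k)
    \<and> ((\<lambda>n. proportion (right_cancellative_pres A) (pres_sum A k n))
           \<longlonglongrightarrow> ((real (card A) - 1) / real (card A)) ^ k)
    \<and> ((\<lambda>n. proportion (cancellative_pres A) (pres_sum A k n))
           \<longlonglongrightarrow> ((real (card A) - 1) / real (card A)) ^ (2 * k))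
    \<and> ((\<lambda>n. proportion (left_cancellative_pres A) (pres_max A k n))
           \<longlonglongrightarrow> ((real (card A) - 1) / real (card A)) ^ k)
    \<and> ((\<lambda>n. proportion (right_cancellative_pres A) (pres_max A k n))
           \<longlonglongrightarrow> ((real (card A) - 1) / real (card A)) ^ k)
    \<and> ((\<lambda>n. proportion (cancellative_pres A) (pres_max A k n))
           \<longlonglongrightarrow> ((real (card A) - 1) / real (card A)) ^ (2 * k))"
proof -
  let ?c = "(real (card A) - 1) / real (card A)"
  have c: "?c \<ge> 0" "?c ^ 2 \<ge> 0" and pos: "card A > 0"
    using assms(2) by simp_all
  \<comment> \<open>The limit lemmas ask for the density from length 2 on, while a condition at one
    end is counted from length 1 on.\<close>
  have ge1: "l \<ge> 2 \<Longrightarrow> l \<ge> 1" for l :: nat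
    by simp
  note L = card_heads_differ[OF assms(1) pos ge1 ge1] small_overlap.left_cancellative_iff
  note R = card_lasts_differ[OF assms(1) pos ge1 ge1] small_overlap.right_cancellative_iff
  have "cancellative_pres A R \<longleftrightarrow> (\<forall>(u, v)\<in>R. hd u \<noteq> hd v \<and> last u \<noteq> last v)"
    if "small_overlap R q" "is_presentation A R" for R q
    using small_overlap.left_cancellative_iff[OF that] small_overlap.right_cancellative_iff[OF that]
    unfolding cancellative_pres_def by blast
  note C = card_heads_lasts_differ[OF assms(1) pos] this
  show ?thesis
    \<comment> \<open>\<open>x ^ (2 * k)\<close> becomes \<open>(x ^ 2) ^ k\<close>, so the
      two-sided case is the instance with density \<open>?c ^ 2\<close>.\<close>
    unfolding power_mult
    by (intro conjI
      proportion_pres_sum_tendsto[OF assms c(1) L] proportion_pres_sum_tendsto[OF assms c(1) R]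
      proportion_pres_sum_tendsto[OF assms c(2) C]
      proportion_pres_max_tendsto[OF assms c(1) L] proportion_pres_max_tendsto[OF assms c(1) R]
      proportion_pres_max_tendsto[OF assms c(2) C])
qed

end
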